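(* Let $f\colon\mathbb{D}\to\mathbb{D}$ be a non-elliptic map with Denjoy--Wolff point $\tau$ and Koenigs domain $\Omega$. Suppose that the Euclidean boundary $\partial\Omega$ is non-polar. Then, for each $z\in\mathbb{D}$ there exists a positive constant $c=c(z)$ such that $$|f^n(z)-\tau|\le\frac{c}{\sqrt{n}}, \quad \text{for all } n\in\mathbb{N}.$$
   Context: $\mathbb{D}$ is the open unit disc and $\mathbb{N}=\{1,2,\dots\}$. A set is non-polar if it has positive logarithmic capacity. A holomorphic map $f\colon\mathbb{D}\to\mathbb{D}$ is non-elliptic if it has no fixed point in $\mathbb{D}$; then there is a unique $\tau\in\partial\mathbb{D}$, the Denjoy--Wolff point of $f$, such that the iterates $f^n(z)$ converge to $\tau$ for all $z\in\mathbb{D}$. A domain $\Omega\subseteq\mathbb{C}$ is starlike at infinity if $\Omega+t\subseteq\Omega$ for all $t\ge 0$; it is asymptotically starlike at infinity if $\Omega+1\subseteq\Omega$ and $\bigcup_{n=1}^\infty(\Omega-n)$ is starlike at infinity. A simply connected domain $U\subseteq\mathbb{D}$ is a fundamental domain of $f$ if $f$ is univalent on $U$, $f(U)\subseteq U$ and $\bigcup_{n\in\mathbb{N}}f^{-n}(U)=\mathbb{D}$. For a non-elliptic $f$, a Koenigs domain and a Koenigs function are a domain $\Omega$ asymptotically starlike at infinity and an onto holomorphic map $h\colon\mathbb{D}\to\Omega$ with $h\circ f=h+1$ and such that $h$ is univalent on some fundamental domain of $f$. Such a pair exists and is unique up to translation. *)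

theory Defs
  imports "HOL-Analysis.Analysis" "HOL-Complex_Analysis.Complex_Analysis"
    "HOL-Probability.Probability_Measure"
begin

abbreviation unit_disc :: "complex set" where
  "unit_disc \<equiv> ball 0 1"

definition plane_domain :: "complex set \<Rightarrow> bool" where
  "plane_domain \<Omega> \<longleftrightarrow> open \<Omega> \<and> connected \<Omega> \<and> \<Omega> \<noteq> {}"

(* The energy is the double integral of log |z - w|, with log 0 = -\<infinity>; it is taken as the
   integral of the positive part minus that of the negative part.  Since ennreal truncates
   negative reals to 0 and ln 0 = 0, only the negative part needs the diagonal singled out.
   For compactly supported finite measures the positive part is finite, so that \<infinity> - \<infinity>
   does not occur. *)
definition log_energy :: "complex measure \<Rightarrow> ereal" where
  "log_energy \<mu> =
     enn2ereal (\<integral>\<^sup>+ z. (\<integral>\<^sup>+ w. ennreal (ln (cmod (z - w))) \<partial>\<mu>) \<partial>\<mu>)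
     - enn2ereal (\<integral>\<^sup>+ z. (\<integral>\<^sup>+ w. (if z = w then \<infinity> else ennreal (- ln (cmod (z - w)))) \<partial>\<mu>) \<partial>\<mu>)"

definition compactly_supported_probs :: "complex set \<Rightarrow> complex measure set" where
  "compactly_supported_probs E =
     {\<mu>. prob_space \<mu> \<and> sets \<mu> = sets borel \<and> (\<exists>K. compact K \<and> K \<subseteq> E \<and> emeasure \<mu> K = 1)}"

(* The supremum of exp (log_energy \<mu>), where exp (-\<infinity>) = 0.  It is \<infinity> for some unbounded E
   and 0 for empty E. *)
definition log_capacity :: "complex set \<Rightarrow> ennreal" where
  "log_capacity E =
     (SUP \<mu>\<in>compactly_supported_probs E.
        if log_energy \<mu> = -\<infinity> then 0 else ennreal (exp (real_of_ereal (log_energy \<mu>))))"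

definition non_polar :: "complex set \<Rightarrow> bool" where
  "non_polar E \<longleftrightarrow> log_capacity E > 0"

definition non_elliptic :: "(complex \<Rightarrow> complex) \<Rightarrow> bool" where
  "non_elliptic f \<longleftrightarrow>
     f holomorphic_on unit_disc \<and> f ` unit_disc \<subseteq> unit_disc \<and> (\<forall>z\<in>unit_disc. f z \<noteq> z)"

definition denjoy_wolff_point :: "(complex \<Rightarrow> complex) \<Rightarrow> complex \<Rightarrow> bool" where
  "denjoy_wolff_point f \<tau> \<longleftrightarrow>
     \<tau> \<in> sphere 0 1 \<and> (\<forall>z\<in>unit_disc. (\<lambda>n. (f ^^ n) z) \<longlonglongrightarrow> \<tau>)"

definition starlike_at_infinity :: "complex set \<Rightarrow> bool" where
  "starlike_at_infinity \<Omega> \<longleftrightarrow>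
     plane_domain \<Omega> \<and> (\<forall>t::real. t \<ge> 0 \<longrightarrow> (\<lambda>w. w + of_real t) ` \<Omega> \<subseteq> \<Omega>)"

definition asymptotically_starlike_at_infinity :: "complex set \<Rightarrow> bool" where
  "asymptotically_starlike_at_infinity \<Omega> \<longleftrightarrow>
     plane_domain \<Omega> \<and> (\<lambda>w. w + 1) ` \<Omega> \<subseteq> \<Omega> \<and>
     starlike_at_infinity (\<Union>n\<in>{1::nat..}. (\<lambda>w. w - of_nat n) ` \<Omega>)"

definition fundamental_domain :: "(complex \<Rightarrow> complex) \<Rightarrow> complex set \<Rightarrow> bool" where
  "fundamental_domain f U \<longleftrightarrow>
     plane_domain U \<and> simply_connected U \<and> U \<subseteq> unit_disc \<and> inj_on f U \<and> f ` U \<subseteq> U \<and>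
     (\<Union>n\<in>{1::nat..}. {z\<in>unit_disc. (f ^^ n) z \<in> U}) = unit_disc"

definition koenigs_pair :: "(complex \<Rightarrow> complex) \<Rightarrow> complex set \<Rightarrow> (complex \<Rightarrow> complex) \<Rightarrow> bool" where
  "koenigs_pair f \<Omega> h \<longleftrightarrow>
     asymptotically_starlike_at_infinity \<Omega> \<and>
     h holomorphic_on unit_disc \<and> h ` unit_disc = \<Omega> \<and>
     (\<forall>z\<in>unit_disc. h (f z) = h z + 1) \<and>
     (\<exists>U. fundamental_domain f U \<and> inj_on h U)"

definition koenigs_domain :: "(complex \<Rightarrow> complex) \<Rightarrow> complex set \<Rightarrow> bool" where
  "koenigs_domain f \<Omega> \<longleftrightarrow> (\<exists>h. koenigs_pair f \<Omega> h)"

end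

theory Submission
  imports Defs
begin

text \<open>Write \<open>z\<^sub>n\<close> for the iterates of a point under \<open>f\<close>. The Koenigs function \<open>h\<close> turns the orbit into the
translates \<open>h z + n\<close>, and since \<open>\<Omega> + 1 \<subseteq> \<Omega>\<close>, no translate \<open>K - k\<close> of a set \<open>K \<subseteq> \<partial>\<Omega>\<close> meets \<open>\<Omega>\<close>. So
\<open>\<Omega>\<close> omits a set that behaves, for potential theory, like the half line \<open>(-\<infinity>, 0]\<close>. On the complement
of the half line, \<open>Re \<surd>w\<close> is a positive harmonic function, and it has size \<open>\<surd>n\<close> near the point \<open>n\<close>.
The proof builds a substitute for it on \<open>\<Omega>\<close> and then compares harmonic functions in the disc.

The substitute on \<open>\<Omega>\<close>. Because \<open>\<partial>\<Omega>\<close> is non-polar, a compact \<open>K \<subseteq> \<partial>\<Omega>\<close> carries a probability measure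
whose logarithmic potential \<open>P(w) = \<integral> ln |w - s| d\<nu>(s)\<close> is bounded below off \<open>K\<close>
(\<open>non_polar_bounded_potential\<close>). The Riesz measure of \<open>Re \<surd>w\<close> has density proportional to \<open>x\<^sup>-\<^sup>1\<^sup>/\<^sup>2\<close> at
\<open>-x\<close>. Placing copies of \<open>\<nu>\<close> on the sets \<open>K - k\<close>, \<open>k < n\<close>, with the weights
\<open>a\<^sub>k = 2 (\<surd>(k + 1) - \<surd>k)\<close>, gives the function \<open>S\<^sub>n(w) = \<Sum>k<n. a\<^sub>k (P(w + k) - ln k)\<close> with \<open>ln 0 = 0\<close>,
which is harmonic on \<open>\<Omega>\<close>. It is bounded below uniformly in \<open>n\<close>, it is bounded above at each point uniformly
in \<open>n\<close>, and it is at least \<open>c \<surd>n - C\<close> where \<open>Re w \<ge> n / 2\<close>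
(\<open>shifted_potential_sum_lower_bounds\<close>, \<open>shifted_potential_sum_upper_bound\<close>). The uniform lower bound is
the delicate point: it rests on \<open>\<integral>\<^sub>0\<^sup>X x\<^sup>-\<^sup>1\<^sup>/\<^sup>2 ln |1 - m / x| dx \<ge> 0\<close>, where the weights \<open>a\<^sub>k\<close> let the
sum be compared with the integral interval by interval (\<open>weighted_log_sum_ge\<close>).

Hence, after adding a constant and dividing by a multiple of \<open>\<surd>n\<close>, \<open>v = S\<^sub>n \<circ> h\<close> becomes a nonnegative
harmonic function on the disc with \<open>v(0) \<le> C / \<surd>n\<close>, and for large \<open>n\<close> it is at least 1 on every
curve \<open>f\<^sup>k([z, f z])\<close>, \<open>k \<ge> n\<close>. These curves join \<open>z\<^sub>n\<close> to points arbitrarily close to \<open>\<tau>\<close>.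

The comparison in the disc. A nonnegative harmonic function that is at least 1 on a curve from \<open>b\<close> to
\<open>\<tau>\<close>, where \<open>b\<close> is near \<open>\<tau>\<close>, satisfies \<open>v(0) \<ge> c |b - \<tau>|\<close> (\<open>distance_le_of_path\<close>). Map the disc to a strip of width \<open>\<pi>\<close>
with \<open>\<tau>\<close> at one end; the curve then runs along the strip. Take an explicit harmonic barrier that vanishes
on three sides of a rectangle across the strip; the set where \<open>v\<close> is smaller than the barrier can
leave the rectangle only through the fourth side. Were \<open>v\<close> small at a point, there would be paths from that point to the
two long sides of the strip along which \<open>v < 1\<close>; together they would cross the curve
(\<open>min_side_barrier_le\<close>). This gives a lower bound for \<open>v\<close> on a segment across the strip, and a second
barrier carries it to the centre, at the cost of a factor comparable to \<open>|b - \<tau>|\<close> (\<open>strip_lower_bound\<close>).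

Harmonicity enters only as the mean value property over circles, which for potentials follows from
Fubini's theorem and which suffices for the maximum principle.\<close>

section \<open>A discretized square root profile\<close>

text \<open>The integral of \<open>x\<^sup>-\<^sup>1\<^sup>/\<^sup>2\<close> over \<open>[k, k + 1]\<close>. With these weights a sum over \<open>k\<close> of terms evaluated at \<open>k\<close>
compares with an integral against \<open>x\<^sup>-\<^sup>1\<^sup>/\<^sup>2 dx\<close> interval by interval, without an error term.\<close>

definition weight :: "nat \<Rightarrow> real" where
  "weight k = 2 * (sqrt (real (Suc k)) - sqrt (real k))"

lemma weight_nonneg: "weight k \<ge> 0"
  by (simp add: weight_def)

lemma sum_weight: "(\<Sum>k<n. weight k) = 2 * sqrt (real n)"
  by (induction n) (simp_all add: weight_def algebra_simps)

lemma weight_le: "weight k \<le> 2 / sqrt (real (Suc k))"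
proof -
  have "(sqrt (real (Suc k)) - sqrt (real k)) * sqrt (real (Suc k))
      \<le> (sqrt (real (Suc k)) - sqrt (real k)) * (sqrt (real (Suc k)) + sqrt (real k))"
    by (intro mult_left_mono) auto
  also have "\<dots> = 1"
    by (simp add: algebra_simps)
  finally show ?thesis
    unfolding weight_def by (simp add: field_simps)
qed

text \<open>The induction works with the stronger bound \<open>3 - 2 / \<surd>n\<close>, which telescopes.\<close>

lemma sum_inverse_three_halves_le: "(\<Sum>k<n. 1 / (real (Suc k) * sqrt (real (Suc k)))) \<le> 3"
proof -
  have "(\<Sum>k<Suc n. 1 / (real (Suc k) * sqrt (real (Suc k)))) \<le> 3 - 2 / sqrt (real (Suc n))" for n
  proof (induction n)
    case (Suc n)
    define a where "a = sqrt (real (Suc n))"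
    define b where "b = sqrt (real (Suc (Suc n)))"
    have pos: "0 < a" "a \<le> b" and sq: "b * b = a * a + 1" "b * b = real (Suc (Suc n))"
      by (auto simp: a_def b_def)
    have "a * (a + b) \<le> b * (b + b)"
      using pos by (intro mult_mono) auto
    then have "a * (a + b) \<le> 2 * (b * b)" by simp
    moreover have "(b - a) * (a + b) = 1"
      using sq by (simp add: algebra_simps)
    ultimately have "a * (a + b) * (b - a) \<le> 2 * (b * b) * (b - a)"
      using pos by (intro mult_right_mono) auto
    moreover have "a * (a + b) * (b - a) = a * ((b - a) * (a + b))"
      by (simp add: mult_ac)
    ultimately have "a \<le> 2 * (b * b) * (b - a)"
      using \<open>(b - a) * (a + b) = 1\<close> by simp
    then have "1 / (b * b * b) \<le> 2 / a - 2 / b"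
      using pos by (simp add: field_simps)
    with Suc show ?case
      unfolding sum.lessThan_Suc[of _ "Suc n"] a_def[symmetric] b_def[symmetric]
      by (simp add: sq(2))
  qed simp
  moreover have "2 / sqrt (real (Suc n)) \<ge> 0" for n
    by simp
  ultimately have "(\<Sum>k<Suc n. 1 / (real (Suc k) * sqrt (real (Suc k)))) \<le> 3" for n
    by (smt (verit))
  then show ?thesis
    by (cases n) auto
qed

definition xlnx :: "real \<Rightarrow> real" where
  "xlnx x = x * ln \<bar>x\<bar>"

text \<open>Half of \<open>\<integral> x\<^sup>-\<^sup>1\<^sup>/\<^sup>2 ln |1 - s\<^sup>2 / x| dx\<close> over \<open>[0, t\<^sup>2]\<close>, in closed form: the substitution \<open>x = t\<^sup>2\<close> turns it
into \<open>\<integral> (ln |t\<^sup>2 - s\<^sup>2| - ln t\<^sup>2) dt\<close>.\<close>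

definition profile :: "real \<Rightarrow> real \<Rightarrow> real" where
  "profile s t = xlnx (t + s) + xlnx (t - s) - 2 * xlnx t"

lemma has_derivative_xlnx:
  assumes "x \<noteq> 0" shows "(xlnx has_real_derivative ln \<bar>x\<bar> + 1) (at x)"
proof -
  consider "x > 0" | "x < 0" using assms by linarith
  then show ?thesis
  proof cases
    case 1
    have "((\<lambda>x. x * ln x) has_real_derivative ln \<bar>x\<bar> + 1) (at x)"
      using 1 by (auto intro!: derivative_eq_intros)
    then show ?thesis
      by (rule DERIV_cong_ev[THEN iffD1, rotated -1, OF _ refl _ refl])
         (use 1 eventually_nhds_in_open[of "{0<..}" x] in \<open>auto simp: xlnx_def elim!: eventually_mono\<close>)
  next
    case 2
    have "((\<lambda>x. x * ln (-x)) has_real_derivative ln \<bar>x\<bar> + 1) (at x)"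
      using 2 by (auto intro!: derivative_eq_intros)
    then show ?thesis
      by (rule DERIV_cong_ev[THEN iffD1, rotated -1, OF _ refl _ refl])
         (use 2 eventually_nhds_in_open[of "{..<0}" x] in \<open>auto simp: xlnx_def elim!: eventually_mono\<close>)
  qed
qed

lemma has_derivative_profile:
  assumes "t > 0" "s \<ge> 0" "t \<noteq> s"
  shows "(profile s has_real_derivative ln (\<bar>t\<^sup>2 - s\<^sup>2\<bar> / t\<^sup>2)) (at t)"
proof -
  have "ln (\<bar>t\<^sup>2 - s\<^sup>2\<bar> / t\<^sup>2) = ln ((t + s) * \<bar>t - s\<bar>) - ln (t * t)"
    using assms by (subst ln_div) (auto simp: power2_eq_square square_diff_square_factored abs_mult)
  also have "\<dots> = ln (t + s) + ln \<bar>t - s\<bar> - 2 * ln t"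
    using assms by (subst (1 2) ln_mult) auto
  finally have eq: "ln (\<bar>t\<^sup>2 - s\<^sup>2\<bar> / t\<^sup>2) = (ln \<bar>t + s\<bar> + 1) * 1 + (ln \<bar>t - s\<bar> + 1) * 1 - 2 * (ln \<bar>t\<bar> + 1)"
    using assms by simp
  have 1: "((\<lambda>t. xlnx (t + s)) has_real_derivative (ln \<bar>t + s\<bar> + 1) * 1) (at t)"
    by (rule DERIV_chain2[OF has_derivative_xlnx]) (use assms in \<open>auto intro!: derivative_eq_intros\<close>)
  have 2: "((\<lambda>t. xlnx (t - s)) has_real_derivative (ln \<bar>t - s\<bar> + 1) * 1) (at t)"
    by (rule DERIV_chain2[OF has_derivative_xlnx]) (use assms in \<open>auto intro!: derivative_eq_intros\<close>)
  show ?thesis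
    unfolding profile_def[abs_def] eq
    by (intro DERIV_diff DERIV_add 1 2 DERIV_cmult has_derivative_xlnx) (use assms in auto)
qed

text \<open>For \<open>t > s\<close> this is the convexity of \<open>x ln x\<close>, in the form \<open>y (ln y - ln t) \<ge> y - t\<close> used for
\<open>y = t \<plusminus> s\<close>. For \<open>t \<le> s\<close> every term of a suitable regrouping is nonnegative.\<close>

lemma profile_nonneg:
  assumes "t > 0" "s \<ge> 0" shows "profile s t \<ge> 0"
proof (cases "t \<le> s")
  case True
  have "profile s t = (s - t) * (ln (s + t) - ln (s - t)) + 2 * t * (ln (s + t) - ln t)"
    using True assms by (simp add: profile_def xlnx_def algebra_simps abs_if)
  also have "\<dots> \<ge> 0"
    using True assms by (cases "s = t") (auto intro!: add_nonneg_nonneg mult_nonneg_nonneg)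
  finally show ?thesis .
next
  case False
  have *: "y - t \<le> y * (ln y - ln t)" if "y > 0" for y
  proof -
    have "1 - t / y \<le> - ln (t / y)"
      using ln_le_minus_one[of "t / y"] that assms by simp
    also have "\<dots> = ln y - ln t"
      using that assms by (simp add: ln_div)
    finally have "y * (1 - t / y) \<le> y * (ln y - ln t)"
      using that by (intro mult_left_mono) auto
    then show ?thesis
      using that by (simp add: algebra_simps)
  qed
  have "profile s t = (t + s) * (ln (t + s) - ln t) + (t - s) * (ln (t - s) - ln t)"
    using False assms by (simp add: profile_def xlnx_def algebra_simps)
  with *[of "t + s"] *[of "t - s"] False assms show ?thesis
    by simp
qed

lemma profile_one_le:
  assumes "s \<ge> 0" shows "profile s 1 \<le> ln (2 + s\<^sup>2) + 3"
proof (cases "s \<le> 1")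
  case True
  have "(1 - s) * ln \<bar>1 - s\<bar> \<le> 0"
    using True assms by (cases "s = 1") (auto intro!: mult_nonneg_nonpos)
  moreover have "(1 + s) * ln \<bar>1 + s\<bar> \<le> 2 * 1"
    using True assms ln_le_minus_one[of "1 + s"] by (intro mult_mono) auto
  moreover have "ln (2 + s\<^sup>2) \<ge> 0"
    by (intro ln_ge_zero) (simp add: add_increasing2)
  moreover have "profile s 1 = (1 + s) * ln \<bar>1 + s\<bar> + (1 - s) * ln \<bar>1 - s\<bar>"
    by (simp add: profile_def xlnx_def)
  ultimately show ?thesis
    by linarith
next
  case False
  have "ln ((s + 1) / (s - 1)) \<le> (s + 1) / (s - 1) - 1"
    using False by (intro ln_le_minus_one) auto
  also have "\<dots> = 2 / (s - 1)"
    using False by (simp add: field_simps)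
  finally have "ln (s + 1) - ln (s - 1) \<le> 2 / (s - 1)"
    using False by (simp add: ln_div)
  then have 1: "(s - 1) * (ln (s + 1) - ln (s - 1)) \<le> 2"
    using False by (simp add: field_simps)
  have "2 * ln (s + 1) = ln ((s + 1) * (s + 1))"
    using False by (subst ln_mult) auto
  also have "\<dots> \<le> ln (2 * (2 + s\<^sup>2))"
    using sum_squares_ge_zero[of "s - 1" 0] False
    by (intro ln_mono) (auto simp: algebra_simps power2_eq_square)
  also have "\<dots> = ln 2 + ln (2 + s\<^sup>2)"
    by (subst ln_mult_pos) (simp_all add: add_pos_nonneg)
  finally have "2 * ln (s + 1) \<le> 1 + ln (2 + s\<^sup>2)"
    using ln_2_less_1 by simp
  have "profile s 1 = (s - 1) * (ln (s + 1) - ln (s - 1)) + 2 * ln (s + 1)"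
    using False by (simp add: profile_def xlnx_def algebra_simps)
  with 1 \<open>2 * ln (s + 1) \<le> 1 + ln (2 + s\<^sup>2)\<close> show ?thesis
    by linarith
qed

text \<open>Over an interval \<open>[\<surd>k, \<surd>(k + 1)]\<close> that does not contain \<open>s\<close> this is the mean value theorem, since
moving \<open>t\<^sup>2\<close> within \<open>[k, k + 1]\<close> changes \<open>|t\<^sup>2 - s\<^sup>2|\<close> by at most 1. If the interval contains the
singularity \<open>s\<close>, the three summands of the profile are estimated separately.\<close>

lemma profile_increment_le:
  assumes s: "s \<ge> 0"
  shows "profile s (sqrt (real (Suc (Suc k)))) - profile s (sqrt (real (Suc k)))
     \<le> (sqrt (real (Suc (Suc k))) - sqrt (real (Suc k))) * (ln (2 + \<bar>real (Suc k) - s\<^sup>2\<bar>) - ln (real (Suc k)))"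
proof -
  define t where "t = sqrt (real (Suc k))"
  define t' where "t' = sqrt (real (Suc (Suc k)))"
  have t: "t > 0" "t < t'" and sq: "t\<^sup>2 = real (Suc k)" "t'\<^sup>2 = real (Suc k) + 1"
    by (auto simp: t_def t'_def)
  have "profile s t' - profile s t \<le> (t' - t) * (ln (2 + \<bar>t\<^sup>2 - s\<^sup>2\<bar>) - ln (t\<^sup>2))"
  proof (cases "t \<le> s \<and> s \<le> t'")
    case False
    have d: "(profile s has_real_derivative ln (\<bar>x\<^sup>2 - s\<^sup>2\<bar> / x\<^sup>2)) (at x)" if "t \<le> x" "x \<le> t'" for x
      using that t False by (intro has_derivative_profile s) auto
    obtain x where x: "t < x" "x < t'"
      and eq: "profile s t' - profile s t = (t' - t) * ln (\<bar>x\<^sup>2 - s\<^sup>2\<bar> / x\<^sup>2)"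
      using MVT2[OF t(2) d] by blast
    have "t\<^sup>2 \<le> x\<^sup>2" "x\<^sup>2 \<le> t'\<^sup>2"
      using x t by (auto intro!: power_mono)
    then have "\<bar>x\<^sup>2 - s\<^sup>2\<bar> \<le> 2 + \<bar>t\<^sup>2 - s\<^sup>2\<bar>"
      using sq by linarith
    moreover have "x\<^sup>2 \<noteq> s\<^sup>2"
      using x t False s by (auto simp: power2_eq_iff)
    ultimately have "ln (\<bar>x\<^sup>2 - s\<^sup>2\<bar>) \<le> ln (2 + \<bar>t\<^sup>2 - s\<^sup>2\<bar>)"
      by (intro ln_mono) auto
    moreover have "ln (t\<^sup>2) \<le> ln (x\<^sup>2)"
      using \<open>t\<^sup>2 \<le> x\<^sup>2\<close> t by (intro ln_mono) auto
    moreover have "ln (\<bar>x\<^sup>2 - s\<^sup>2\<bar> / x\<^sup>2) = ln (\<bar>x\<^sup>2 - s\<^sup>2\<bar>) - ln (x\<^sup>2)"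
      using \<open>x\<^sup>2 \<noteq> s\<^sup>2\<close> x t by (intro ln_divide_pos) auto
    ultimately have "ln (\<bar>x\<^sup>2 - s\<^sup>2\<bar> / x\<^sup>2) \<le> ln (2 + \<bar>t\<^sup>2 - s\<^sup>2\<bar>) - ln (t\<^sup>2)"
      by linarith
    then show ?thesis
      unfolding eq using t by (intro mult_left_mono) auto
  next
    case True
    have d: "(xlnx has_real_derivative ln x + 1) (at x)" if "x > 0" for x
      using has_derivative_xlnx[of x] that by simp
    obtain x where x: "t + s < x" "x < t' + s"
      and eq1: "xlnx (t' + s) - xlnx (t + s) = ((t' + s) - (t + s)) * (ln x + 1)"
      using MVT2[of "t + s" "t' + s" xlnx "\<lambda>x. ln x + 1", OF _ d] s t by auto
    obtain y where y: "t < y" "y < t'"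
      and eq2: "xlnx t' - xlnx t = (t' - t) * (ln y + 1)"
      using MVT2[of t t' xlnx "\<lambda>x. ln x + 1", OF _ d] t by auto
    \<comment> \<open>The middle summand (\<open>b3\<close>) is bounded without the constant 1 of the derivative \<open>ln x + 1\<close>, so the constants
        add up to \<open>1 - 2 < 0\<close>.\<close>
    have b1: "xlnx (t' + s) - xlnx (t + s) \<le> (t' - t) * (ln (2 * t') + 1)"
      unfolding eq1 using x True t s by (auto intro!: mult_left_mono ln_mono)
    have b2: "(t' - t) * (ln t + 1) \<le> xlnx t' - xlnx t"
      unfolding eq2 using y t by (auto intro!: mult_left_mono ln_mono)
    have *: "u * ln u \<le> u * ln (t' - t)" if "0 \<le> u" "u \<le> t' - t" for u
      using that by (cases "u = 0") (auto intro!: mult_left_mono ln_mono)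
    have "xlnx (t' - s) - xlnx (t - s) = (t' - s) * ln (t' - s) + (s - t) * ln (s - t)"
    proof -
      have "\<bar>t - s\<bar> = s - t" "\<bar>t' - s\<bar> = t' - s"
        using True by auto
      then show ?thesis
        unfolding xlnx_def by (metis diff_minus_eq_add minus_diff_eq mult_minus_left)
    qed
    also have "\<dots> \<le> (t' - s) * ln (t' - t) + (s - t) * ln (t' - t)"
      using True by (intro add_mono *) auto
    finally have b3: "xlnx (t' - s) - xlnx (t - s) \<le> (t' - t) * ln (t' - t)"
      by (simp add: algebra_simps)
    have "profile s t' - profile s t
        \<le> (t' - t) * (ln (2 * t') + 1 + ln (t' - t) - 2 * (ln t + 1))"
      using b1 b2 b3 unfolding profile_def by (simp add: algebra_simps)
    also have "\<dots> \<le> (t' - t) * (ln (2 + \<bar>t\<^sup>2 - s\<^sup>2\<bar>) - ln (t\<^sup>2))"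
    proof (intro mult_left_mono)
      have "2 * (t' + t) * (t' - t) = 2"
        using sq by (simp add: algebra_simps power2_eq_square)
      moreover have "2 * t' * (t' - t) \<le> 2 * (t' + t) * (t' - t)"
        using t by (intro mult_right_mono) auto
      ultimately have "2 * t' * (t' - t) \<le> 2 + \<bar>t\<^sup>2 - s\<^sup>2\<bar>"
        using abs_ge_zero[of "t\<^sup>2 - s\<^sup>2"] by linarith
      then have "ln (2 * t') + ln (t' - t) \<le> ln (2 + \<bar>t\<^sup>2 - s\<^sup>2\<bar>)"
        using t by (subst ln_mult_pos[symmetric]) (auto intro!: ln_mono)
      moreover have "ln (t\<^sup>2) = 2 * ln t"
        using t by (simp add: ln_realpow)
      ultimately show "ln (2 * t') + 1 + ln (t' - t) - 2 * (ln t + 1) \<le> ln (2 + \<bar>t\<^sup>2 - s\<^sup>2\<bar>) - ln (t\<^sup>2)"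
        by simp
    qed (use t in auto)
    finally show ?thesis .
  qed
  then show ?thesis
    unfolding sq(1) unfolding t_def t'_def .
qed

text \<open>For \<open>u < 0\<close> the sum dominates, term by term, the increments of twice the profile with \<open>s\<^sup>2 = -u\<close>, so it is at least
twice the profile at \<open>\<surd>n\<close>, up to the contribution of \<open>k = 0\<close>. The term \<open>k = 0\<close> uses \<open>ln 0 = 0\<close>.\<close>

lemma weighted_log_sum_ge:
  "(\<Sum>k<n. weight k * (ln (2 + \<bar>real k + u\<bar>) - ln (real k))) \<ge> - 6"
proof (cases "u \<ge> 0")
  case True
  have "weight k * (ln (2 + \<bar>real k + u\<bar>) - ln (real k)) \<ge> 0" for k
    using True by (cases "k = 0") (auto intro!: mult_nonneg_nonneg weight_nonneg ln_mono)
  then have "(\<Sum>k<n. weight k * (ln (2 + \<bar>real k + u\<bar>) - ln (real k))) \<ge> 0"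
    by (intro sum_nonneg) auto
  then show ?thesis by linarith
next
  case False
  define s where "s = sqrt (- u)"
  have s: "s \<ge> 0" and u: "\<bar>real k + u\<bar> = \<bar>real k - s\<^sup>2\<bar>" for k
    using False by (auto simp: s_def)
  have "(\<Sum>k<Suc n. weight k * (ln (2 + \<bar>real k + u\<bar>) - ln (real k)))
      \<ge> 2 * profile s (sqrt (real (Suc n))) - 6" for n
  proof (induction n)
    case 0
    show ?case
      using profile_one_le[OF s] u[of 0] by (simp add: weight_def)
  next
    case (Suc n)
    have "2 * (profile s (sqrt (real (Suc (Suc n)))) - profile s (sqrt (real (Suc n))))
       \<le> weight (Suc n) * (ln (2 + \<bar>real (Suc n) + u\<bar>) - ln (real (Suc n)))"
      using profile_increment_le[OF s, of n] unfolding weight_def u by (simp only: mult.assoc mult_le_cancel_left_pos zero_less_numeral)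
    with Suc show ?case
      unfolding sum.lessThan_Suc[of _ "Suc n"] by simp
  qed
  moreover have "profile s (sqrt (real (Suc n))) \<ge> 0" for n
    using s by (intro profile_nonneg) auto
  ultimately have "(\<Sum>k<Suc n. weight k * (ln (2 + \<bar>real k + u\<bar>) - ln (real k))) \<ge> - 6" for n
    by (smt (verit))
  then show ?thesis
    by (cases n) auto
qed

text \<open>To the right of \<open>n / 2\<close> every factor \<open>ln (2 + |k + u|) - ln k\<close> with \<open>k < n\<close> is at least \<open>ln (3 / 2)\<close>, and the
weights add up to \<open>2 \<surd>n\<close>.\<close>

lemma weighted_log_sum_ge_sqrt:
  assumes "u \<ge> real n / 2"
  shows "(\<Sum>k<n. weight k * (ln (2 + \<bar>real k + u\<bar>) - ln (real k))) \<ge> 2 * ln (3 / 2) * sqrt (real n)"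
proof -
  have "weight k * ln (3 / 2) \<le> weight k * (ln (2 + \<bar>real k + u\<bar>) - ln (real k))" if "k < n" for k
  proof (intro mult_left_mono weight_nonneg)
    show "ln (3 / 2) \<le> ln (2 + \<bar>real k + u\<bar>) - ln (real k)"
    proof (cases "k = 0")
      case False
      have "ln (3 / 2 * real k) \<le> ln (2 + \<bar>real k + u\<bar>)"
        using False that assms by (intro ln_mono) auto
      then show ?thesis
        using False by (subst (asm) ln_mult) auto
    qed (use assms in \<open>auto intro!: ln_mono\<close>)
  qed
  then have "(\<Sum>k<n. weight k * ln (3 / 2)) \<le> (\<Sum>k<n. weight k * (ln (2 + \<bar>real k + u\<bar>) - ln (real k)))"
    by (intro sum_mono) auto
  then show ?thesis
    by (simp add: sum_distrib_right[symmetric] sum_weight mult_ac)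
qed

text \<open>As \<open>ln (B + k) - ln k \<le> B / k\<close> and the weights decay like \<open>1 / \<surd>k\<close>, the terms are summable.\<close>

lemma weighted_log_sum_le:
  assumes "B \<ge> 1"
  shows "(\<Sum>k<n. weight k * (ln (B + real k) - ln (real k))) \<le> 2 * ln B + 12 * B"
proof -
  have 1: "weight k * (ln (B + real k) - ln (real k))
      \<le> (if k = 0 then 2 * ln B else 0) + 4 * B * (1 / (real (Suc k) * sqrt (real (Suc k))))" for k
  proof (cases "k = 0")
    case True
    then show ?thesis using assms by (simp add: weight_def)
  next
    case False
    have "ln (B + real k) - ln (real k) = ln ((B + real k) / real k)"
      using False assms by (subst ln_div) auto
    also have "\<dots> \<le> (B + real k) / real k - 1"
      using False assms by (intro ln_le_minus_one) auto
    also have "\<dots> = B / real k"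
      using False by (simp add: field_simps)
    also have "\<dots> \<le> 2 * B / real (Suc k)"
      using False assms by (simp add: field_simps)
    finally have "weight k * (ln (B + real k) - ln (real k)) \<le> 2 / sqrt (real (Suc k)) * (2 * B / real (Suc k))"
      using False assms by (intro mult_mono weight_le) auto
    then show ?thesis
      using False by (simp add: mult_ac)
  qed
  have "(\<Sum>k<n. weight k * (ln (B + real k) - ln (real k)))
     \<le> (\<Sum>k<n. (if k = 0 then 2 * ln B else 0) + 4 * B * (1 / (real (Suc k) * sqrt (real (Suc k)))))"
    by (intro sum_mono 1)
  also have "\<dots> = (\<Sum>k<n. if k = 0 then 2 * ln B else 0)
      + 4 * B * (\<Sum>k<n. 1 / (real (Suc k) * sqrt (real (Suc k))))"
    unfolding sum.distrib sum_distrib_left ..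
  also have "\<dots> \<le> 2 * ln B + 4 * B * 3"
    using assms by (intro add_mono mult_left_mono sum_inverse_three_halves_le) (auto simp: sum.delta)
  finally show ?thesis by simp
qed

text \<open>Splitting at \<open>m\<close> gives two partial sums of the series bounded in \<open>sum_inverse_three_halves_le\<close>.\<close>

lemma sum_inverse_three_halves_dist_le:
  "(\<Sum>k<n. 1 / ((1 + \<bar>real k - real m\<bar>) * sqrt (1 + \<bar>real k - real m\<bar>))) \<le> 6"
proof -
  define z where "z j = 1 / (real (Suc j) * sqrt (real (Suc j)))" for j
  have z: "1 / ((1 + \<bar>real k - real m\<bar>) * sqrt (1 + \<bar>real k - real m\<bar>)) = (if m \<le> k then z (k - m) else z (m - k))" for k
    by (auto simp: z_def of_nat_diff abs_if)
  have znn: "z j \<ge> 0" for j by (simp add: z_def)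
  have "(\<Sum>k<n. if m \<le> k then z (k - m) else z (m - k))
      = (\<Sum>k\<in>{..<n} \<inter> {m..}. z (k - m)) + (\<Sum>k\<in>{..<n} \<inter> {..<m}. z (m - k))"
    by (subst sum.If_cases) (auto simp: Collect_neg_eq intro!: arg_cong2[where f="(+)"] sum.cong)
  also have "(\<Sum>k\<in>{..<n} \<inter> {m..}. z (k - m)) = (\<Sum>j\<in>(\<lambda>k. k - m) ` ({..<n} \<inter> {m..}). z j)"
    by (subst sum.reindex) (auto simp: inj_on_def)
  also have "\<dots> \<le> (\<Sum>j<n. z j)"
    by (intro sum_mono2 znn) auto
  also have "(\<Sum>k\<in>{..<n} \<inter> {..<m}. z (m - k)) = (\<Sum>j\<in>(\<lambda>k. m - k) ` ({..<n} \<inter> {..<m}). z j)"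
    by (subst sum.reindex) (auto simp: inj_on_def)
  also have "\<dots> \<le> (\<Sum>j<Suc m. z j)"
    by (intro sum_mono2 znn) auto
  finally show ?thesis
    unfolding z using sum_inverse_three_halves_le[of n] sum_inverse_three_halves_le[of "Suc m"]
    unfolding z_def by linarith
qed

text \<open>The total of the dipole errors that occur when the potential of the \<open>k\<close>-th copy of the measure is replaced
by a logarithm of the distance. The bound is uniform in \<open>u\<close>: for positive \<open>x, y\<close> one has
\<open>1 / (y \<surd>x) \<le> 1 / (x \<surd>x) + 1 / (y \<surd>y)\<close>, and both terms on the right sum to at most a constant.\<close>

lemma weighted_inverse_sum_le:
  "(\<Sum>k<n. weight k / (1 + \<bar>real k + u\<bar>)) \<le> 36"
proof -
  define m where "m = nat \<lfloor>- u\<rfloor>"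
  have "(1 + \<bar>real k - real m\<bar>) / 2 \<le> 1 + \<bar>real k + u\<bar>" for k
  proof (cases "u \<le> 0")
    case True
    then have "real m \<le> - u" "- u < real m + 1"
      unfolding m_def by linarith+
    then show ?thesis by (simp add: abs_if)
  next
    case False
    then have "m = 0" by (simp add: m_def)
    then show ?thesis using False by simp
  qed
  note * = this
  have 1: "weight k / (1 + \<bar>real k + u\<bar>)
     \<le> 4 * (1 / (real (Suc k) * sqrt (real (Suc k))))
      + 4 * (1 / ((1 + \<bar>real k - real m\<bar>) * sqrt (1 + \<bar>real k - real m\<bar>)))" for k
  proof -
    define a where "a = 1 + real k"
    define b where "b = 1 + \<bar>real k - real m\<bar>"
    have ab: "a > 0" "b > 0" by (auto simp: a_def b_def add_pos_nonneg)
    have "weight k / (1 + \<bar>real k + u\<bar>) \<le> (2 / sqrt a) / (b / 2)"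
      using weight_le[of k] weight_nonneg[of k] *[of k] ab
      by (intro frac_le) (auto simp: a_def b_def)
    also have "\<dots> = 4 * (1 / (b * sqrt a))"
      by simp
    also have "\<dots> \<le> 4 * (1 / (a * sqrt a)) + 4 * (1 / (b * sqrt b))"
    proof (cases "a \<le> b")
      case True
      then have "1 / (b * sqrt a) \<le> 1 / (a * sqrt a)"
        using ab by (intro frac_le mult_right_mono) auto
      moreover have "0 \<le> 1 / (b * sqrt b)"
        using ab by simp
      ultimately show ?thesis by linarith
    next
      case False
      then have "1 / (b * sqrt a) \<le> 1 / (b * sqrt b)"
        using ab by (intro frac_le mult_left_mono) auto
      moreover have "0 \<le> 1 / (a * sqrt a)"
        using ab by simp
      ultimately show ?thesis by linarith
    qed
    finally show ?thesis by (simp add: a_def b_def)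
  qed
  have "(\<Sum>k<n. weight k / (1 + \<bar>real k + u\<bar>))
    \<le> (\<Sum>k<n. 4 * (1 / (real (Suc k) * sqrt (real (Suc k))))
      + 4 * (1 / ((1 + \<bar>real k - real m\<bar>) * sqrt (1 + \<bar>real k - real m\<bar>))))"
    by (intro sum_mono 1)
  also have "\<dots> \<le> 36"
    unfolding sum.distrib sum_distrib_left[symmetric]
    using sum_inverse_three_halves_le[of n] sum_inverse_three_halves_dist_le[of m n] by linarith
  finally show ?thesis .
qed

section \<open>The mean value property and the maximum principle\<close>

text \<open>For open \<open>S\<close> this characterizes harmonic functions. Being linear and stable under averaging over a
parameter, it can be checked for potentials without differentiating.\<close>

definition mean_value_on :: "complex set \<Rightarrow> (complex \<Rightarrow> real) \<Rightarrow> bool" where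
  "mean_value_on S \<phi> \<longleftrightarrow> continuous_on S \<phi> \<and>
     (\<forall>c r. r > 0 \<longrightarrow> cball c r \<subseteq> S \<longrightarrow> ((\<lambda>t. \<phi> (circlepath c r t)) has_integral \<phi> c) {0..1})"

lemma mean_value_onD:
  assumes "mean_value_on S \<phi>"
  shows "continuous_on S \<phi>"
    and "\<lbrakk>r > 0; cball c r \<subseteq> S\<rbrakk> \<Longrightarrow> ((\<lambda>t. \<phi> (circlepath c r t)) has_integral \<phi> c) {0..1}"
  using assms by (auto simp: mean_value_on_def)

lemma circlepath_mem_cball: "r \<ge> 0 \<Longrightarrow> circlepath c r t \<in> cball c r"
  by (simp add: circlepath dist_norm norm_mult)

lemma circlepath_minus_center: "circlepath c r t - c = of_real r * exp (2 * of_real pi * \<i> * of_real t)"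
  by (simp add: circlepath)

lemma mean_value_on_diff:
  "mean_value_on S \<phi> \<Longrightarrow> mean_value_on S \<psi> \<Longrightarrow> mean_value_on S (\<lambda>z. \<phi> z - \<psi> z)"
  unfolding mean_value_on_def by (auto intro!: continuous_on_diff has_integral_diff)

lemma mean_value_on_add:
  "mean_value_on S \<phi> \<Longrightarrow> mean_value_on S \<psi> \<Longrightarrow> mean_value_on S (\<lambda>z. \<phi> z + \<psi> z)"
  unfolding mean_value_on_def by (auto intro!: continuous_on_add has_integral_add)

lemma mean_value_on_cmult:
  "mean_value_on S \<phi> \<Longrightarrow> mean_value_on S (\<lambda>z. a * \<phi> z)"
  unfolding mean_value_on_def by (auto intro!: continuous_on_mult has_integral_mult_right)

lemma mean_value_on_const: "mean_value_on S (\<lambda>z. a)"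
  unfolding mean_value_on_def using has_integral_const_real[of a 0 1] by auto

lemma mean_value_on_sum:
  "(\<And>i. i \<in> I \<Longrightarrow> mean_value_on S (\<phi> i)) \<Longrightarrow> mean_value_on S (\<lambda>z. \<Sum>i\<in>I. \<phi> i z)"
  by (induction I rule: infinite_finite_induct)
     (auto intro: mean_value_on_add mean_value_on_const)

lemma mean_value_on_cong:
  assumes "mean_value_on S \<phi>" "\<And>z. z \<in> S \<Longrightarrow> \<phi> z = \<psi> z"
  shows "mean_value_on S \<psi>"
  unfolding mean_value_on_def
proof (intro conjI allI impI)
  show "continuous_on S \<psi>"
    using assms continuous_on_cong by (auto simp: mean_value_on_def)
  fix c and r :: real assume r: "0 < r" "cball c r \<subseteq> S"
  have "((\<lambda>t. \<phi> (circlepath c r t)) has_integral \<phi> c) {0..1}"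
    by (rule mean_value_onD(2)[OF assms(1) r])
  moreover have "\<phi> (circlepath c r t) = \<psi> (circlepath c r t)" for t
    using circlepath_mem_cball[of r c t] r assms(2) by (auto simp: less_imp_le)
  moreover have "\<phi> c = \<psi> c"
    using r assms(2) by (simp add: subset_iff)
  ultimately show "((\<lambda>t. \<psi> (circlepath c r t)) has_integral \<psi> c) {0..1}"
    by simp
qed

lemma circle_mean_holomorphic:
  assumes "F holomorphic_on cball c r" "r > 0"
  shows "((\<lambda>t. F (circlepath c r t)) has_integral F c) {0..1}"
proof -
  have "((\<lambda>u. F u / (u - c)) has_contour_integral (2 * of_real pi * \<i> * F c)) (circlepath c r)"
    using assms by (intro Cauchy_integral_circlepath_simple) auto
  then have "((\<lambda>t. F (circlepath c r t) / (circlepath c r t - c)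
      * vector_derivative (circlepath c r) (at t within {0..1})) has_integral (2 * of_real pi * \<i> * F c)) {0..1}"
    by (simp add: has_contour_integral_def)
  then have "((\<lambda>t. 2 * of_real pi * \<i> * F (circlepath c r t)) has_integral (2 * of_real pi * \<i> * F c)) {0..1}"
    by (rule has_integral_eq[rotated])
       (use assms in \<open>auto simp: vector_derivative_circlepath01 circlepath_minus_center mult_ac\<close>)
  from has_integral_mult_right[OF this, of "inverse (2 * of_real pi * \<i>)"] show ?thesis
    by (simp add: field_simps)
qed

lemma mean_value_on_Re:
  assumes "F holomorphic_on S"
  shows "mean_value_on S (\<lambda>z. Re (F z))"
  unfolding mean_value_on_def
proof (intro conjI allI impI)
  show "continuous_on S (\<lambda>z. Re (F z))"
    using assms by (intro continuous_intros holomorphic_on_imp_continuous_on)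
  fix c and r :: real assume "0 < r" "cball c r \<subseteq> S"
  then have "((\<lambda>t. F (circlepath c r t)) has_integral F c) {0..1}"
    using circle_mean_holomorphic[OF holomorphic_on_subset[OF assms]] by blast
  then show "((\<lambda>t. Re (F (circlepath c r t))) has_integral Re (F c)) {0..1}"
    by (rule has_integral_Re)
qed

text \<open>On the circle, \<open>|z|\<^sup>2\<close> is the real part of an affine function of \<open>z\<close>. The strict excess \<open>r\<^sup>2\<close> over the value
at the centre makes \<open>|z|\<^sup>2\<close> the perturbation in the maximum principle.\<close>

lemma circle_mean_norm_squared:
  assumes "r > 0"
  shows "((\<lambda>t. (cmod (circlepath c r t))\<^sup>2) has_integral ((cmod c)\<^sup>2 + r\<^sup>2)) {0..1}"
proof -
  have "((\<lambda>t. Re (2 * cnj c * circlepath c r t)) has_integral Re (2 * cnj c * c)) {0..1}"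
    using assms by (intro mean_value_onD(2)[OF mean_value_on_Re[of "\<lambda>z. 2 * cnj c * z" UNIV]] holomorphic_intros) auto
  from has_integral_add[OF this has_integral_const_real[of "r\<^sup>2 - (cmod c)\<^sup>2" 0 1]]
  have "((\<lambda>t. Re (2 * cnj c * circlepath c r t) + (r\<^sup>2 - (cmod c)\<^sup>2)) has_integral
      (Re (2 * cnj c * c) + (r\<^sup>2 - (cmod c)\<^sup>2))) {0..1}" by simp
  moreover have "Re (2 * cnj c * c) + (r\<^sup>2 - (cmod c)\<^sup>2) = (cmod c)\<^sup>2 + r\<^sup>2"
    unfolding cmod_power2 by (simp add: power2_eq_square)
  moreover have "Re (2 * cnj c * z) + (r\<^sup>2 - (cmod c)\<^sup>2) = (cmod z)\<^sup>2"
    if "cmod (z - c) = r" for z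
    unfolding that[symmetric] cmod_power2 by (simp add: power2_eq_square algebra_simps)
  moreover have "cmod (circlepath c r t - c) = r" for t
    using assms by (simp add: circlepath norm_mult)
  ultimately show ?thesis by simp
qed

text \<open>If \<open>\<phi>\<close> were positive somewhere, then \<open>\<phi> + \<epsilon> |z|\<^sup>2\<close> would, for small \<open>\<epsilon>\<close>, attain its maximum over \<open>S\<close> at an
interior point, although its circle means exceed its value at the centre.\<close>

lemma maximum_principle:
  assumes mv: "mean_value_on T \<phi>" and S: "compact S" "S \<subseteq> T"
    and bd: "\<And>z. z \<in> frontier S \<Longrightarrow> \<phi> z \<le> 0" and p: "p \<in> S"
  shows "\<phi> p \<le> 0"
proof (rule ccontr)
  assume "\<not> \<phi> p \<le> 0"
  then have pos: "\<phi> p > 0" by simp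
  obtain B where B: "B > 0" "\<And>z. z \<in> S \<Longrightarrow> cmod z \<le> B"
    using S(1) compact_imp_bounded bounded_pos by metis
  define \<epsilon> where "\<epsilon> = \<phi> p / (2 * B\<^sup>2)"
  have \<epsilon>: "\<epsilon> > 0" using pos B by (simp add: \<epsilon>_def)
  define \<psi> where "\<psi> z = \<phi> z + \<epsilon> * (cmod z)\<^sup>2" for z
  have "continuous_on S \<psi>"
    unfolding \<psi>_def using mean_value_onD(1)[OF mv] S(2)
    by (intro continuous_intros) (auto intro: continuous_on_subset)
  then obtain c where c: "c \<in> S" "\<And>z. z \<in> S \<Longrightarrow> \<psi> z \<le> \<psi> c"
    using continuous_attains_sup[OF S(1)] p by blast
  have "\<epsilon> * B\<^sup>2 < \<phi> p"
    using pos B by (simp add: \<epsilon>_def)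
  also have "\<phi> p \<le> \<psi> p"
    using \<epsilon> by (simp add: \<psi>_def)
  also have "\<psi> p \<le> \<psi> c"
    using c p by blast
  finally have big: "\<epsilon> * B\<^sup>2 < \<psi> c" .
  have "c \<notin> frontier S"
  proof
    assume "c \<in> frontier S"
    moreover have "\<epsilon> * (cmod c)\<^sup>2 \<le> \<epsilon> * B\<^sup>2"
      using \<epsilon> B(2)[OF c(1)] by (intro mult_left_mono power_mono) auto
    ultimately show False
      using bd[of c] big by (simp add: \<psi>_def)
  qed
  then have "c \<in> interior S"
    using c(1) S(1) by (simp add: frontier_def compact_imp_closed)
  then obtain r where r: "r > 0" "cball c r \<subseteq> S"
    using mem_interior_cball by blast
  have "((\<lambda>t. \<phi> (circlepath c r t) + \<epsilon> * (cmod (circlepath c r t))\<^sup>2) has_integral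
      (\<phi> c + \<epsilon> * ((cmod c)\<^sup>2 + r\<^sup>2))) {0..1}"
    using r S(2) by (intro has_integral_add has_integral_mult_right circle_mean_norm_squared
        mean_value_onD(2)[OF mv]) auto
  moreover have "((\<lambda>t::real. \<psi> c) has_integral \<psi> c) {0..1}"
    using has_integral_const_real[of "\<psi> c" 0 1] by simp
  ultimately have "\<phi> c + \<epsilon> * ((cmod c)\<^sup>2 + r\<^sup>2) \<le> \<psi> c"
    by (rule has_integral_le)
       (use c(2) r circlepath_mem_cball[of r c] in \<open>force simp: \<psi>_def\<close>)
  then have "\<epsilon> * r\<^sup>2 \<le> 0"
    by (simp add: \<psi>_def algebra_simps)
  then show False
    using \<epsilon> r(1) by (smt (verit) mult_pos_pos zero_less_power)
qed

text \<open>A component of \<open>{\<phi> > 0}\<close> in \<open>W\<close> that avoided \<open>B\<close> would have \<open>\<phi> \<le> 0\<close> on its frontier, against the maximum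
principle. So \<open>B\<close> describes the only part of the boundary through which the component can leave.\<close>

lemma positive_component_exits:
  assumes mv: "mean_value_on T \<phi>" and W: "open W" "bounded W" "closure W \<subseteq> T"
    and bd: "\<And>z. z \<in> frontier W \<Longrightarrow> z \<in> closure (W - B) \<Longrightarrow> \<phi> z \<le> 0"
    and c: "c \<in> W" "\<phi> c > 0"
  obtains g where "path g" "path_image g \<subseteq> {z\<in>W. \<phi> z > 0}" "pathstart g = c" "pathfinish g \<in> B"
proof -
  define P where "P = {z\<in>W. \<phi> z > 0}"
  have WT: "W \<subseteq> T" using W(3) closure_subset by blast
  have "open P"
  proof -
    have "open (\<phi> -` {0<..} \<inter> W)"
      using continuous_on_subset[OF mean_value_onD(1)[OF mv] WT] W(1)
      by (simp add: continuous_on_open_vimage)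
    moreover have "\<phi> -` {0<..} \<inter> W = P" by (auto simp: P_def)
    ultimately show ?thesis by simp
  qed
  define C where "C = connected_component_set P c"
  have C: "open C" "C \<subseteq> P" "c \<in> C" "connected C"
    unfolding C_def using \<open>open P\<close> c
    by (auto simp: open_connected_component connected_component_subset P_def intro!: connected_component_refl)
  have "C \<inter> B \<noteq> {}"
  proof
    assume CB: "C \<inter> B = {}"
    have CW: "C \<subseteq> W - B" using C(2) CB by (auto simp: P_def)
    have "compact (closure C)"
      using W(2) CW by (meson Diff_subset bounded_subset compact_closure order_trans)
    moreover have "closure C \<subseteq> T"
      using CW W(3) by (meson Diff_subset closure_mono order_trans)
    moreover have "\<phi> z \<le> 0" if z: "z \<in> frontier (closure C)" for z
    proof -
      have zC: "z \<in> closure C" "z \<notin> C"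
        using z interior_maximal[OF closure_subset C(1)] by (auto simp: frontier_def)
      show ?thesis
      proof (cases "z \<in> W")
        case True
        show ?thesis
        proof (rule ccontr)
          assume "\<not> \<phi> z \<le> 0"
          then have "z \<in> P" using True by (simp add: P_def)
          have "connected (insert z C)"
            by (rule connected_intermediate_closure[OF C(4)]) (use zC(1) closure_subset in auto)
          then have "insert z C \<subseteq> connected_component_set P c"
            using C \<open>z \<in> P\<close> by (intro connected_component_maximal) auto
          then show False using zC by (simp add: C_def)
        qed
      next
        case False
        have "z \<in> closure (W - B)" using zC CW closure_mono by blast
        moreover have "z \<in> frontier W"
          using False calculation W(1) closure_mono[of "W - B" W] by (auto simp: frontier_def interior_open)
        ultimately show ?thesis using bd by blast
      qed
    qed
    moreover have "c \<in> closure C"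
      using C(3) closure_subset by blast
    ultimately have "\<phi> c \<le> 0"
      by (rule maximum_principle[OF mv])
    then show False using c by simp
  qed
  then obtain e where e: "e \<in> C" "e \<in> B" by blast
  have "path_connected C"
    using C(1,4) by (rule connected_open_path_connected)
  then obtain g where "path g" "path_image g \<subseteq> C" "pathstart g = c" "pathfinish g = e"
    using C(3) e(1) unfolding path_connected_def by blast
  then show thesis
    using that e(2) C(2) unfolding P_def by blast
qed

section \<open>Crossing paths\<close>

text \<open>The Fashoda theorem for paths that may leave the box through the sides that they are meant to reach: \<open>p\<close> stays
between the horizontal sides, \<open>g\<close> between the vertical ones.\<close>

lemma crossing_paths_meet:
  fixes p g :: "real \<Rightarrow> complex"
  assumes p: "path p" "Re (pathstart p) \<le> x1" "x2 \<le> Re (pathfinish p)"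
      "\<And>z. z \<in> path_image p \<Longrightarrow> y1 < Im z \<and> Im z < y2"
    and g: "path g" "Im (pathstart g) \<le> y1" "y2 \<le> Im (pathfinish g)"
      "\<And>z. z \<in> path_image g \<Longrightarrow> x1 < Re z \<and> Re z < x2"
  obtains z where "z \<in> path_image p" "z \<in> path_image g"
proof -
  define a b :: "real^2" where "a = (\<chi> i. if i = 1 then x1 else y1)" and "b = (\<chi> i. if i = 1 then x2 else y2)"
  \<comment> \<open>Clamping pushes the end points onto the sides of the box and creates no new meeting point.\<close>
  define P :: "real \<Rightarrow> real^2" where "P t = (\<chi> i. if i = 1 then max x1 (min x2 (Re (p t))) else Im (p t))" for t
  define G :: "real \<Rightarrow> real^2" where "G t = (\<chi> i. if i = 1 then Re (g t) else max y1 (min y2 (Im (g t))))" for t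
  have ne: "(2::2) \<noteq> 1" by simp
  have xy: "x1 < x2" "y1 < y2"
    using g(4)[of "pathstart g"] p(4)[of "pathstart p"] by (auto simp: pathstart_in_path_image)
  have pin: "y1 < Im (p t) \<and> Im (p t) < y2" if "t \<in> {0..1}" for t
    using p(4) that by (simp add: path_image_def)
  have gin: "x1 < Re (g t) \<and> Re (g t) < x2" if "t \<in> {0..1}" for t
    using g(4) that by (simp add: path_image_def)
  have cont: "continuous_on {0..1} p" "continuous_on {0..1} g"
    using p(1) g(1) by (auto simp: path_def)
  have "path P" unfolding path_def P_def
  proof (rule continuous_on_vec_lambda)
    show "continuous_on {0..1} (\<lambda>t. if i = 1 then max x1 (min x2 (Re (p t))) else Im (p t))" for i :: 2
      by (cases "i = 1") (auto intro!: continuous_intros cont)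
  qed
  moreover have "path G" unfolding path_def G_def
  proof (rule continuous_on_vec_lambda)
    show "continuous_on {0..1} (\<lambda>t. if i = 1 then Re (g t) else max y1 (min y2 (Im (g t))))" for i :: 2
      by (cases "i = 1") (auto intro!: continuous_intros cont)
  qed
  moreover have "path_image P \<subseteq> cbox a b"
    using pin xy by (auto simp: path_image_def mem_box_cart forall_2 a_def b_def P_def less_imp_le)
  moreover have "path_image G \<subseteq> cbox a b"
    using gin xy by (auto simp: path_image_def mem_box_cart forall_2 a_def b_def G_def less_imp_le)
  moreover have "pathstart P $ 1 = a $ 1" "pathfinish P $ 1 = b $ 1" "pathstart G $ 2 = a $ 2" "pathfinish G $ 2 = b $ 2"
    using p(2,3) g(2,3) xy by (auto simp: pathstart_def pathfinish_def P_def G_def a_def b_def)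
  ultimately obtain w where "w \<in> path_image P" "w \<in> path_image G"
    by (rule fashoda)
  then obtain t u where t: "t \<in> {0..1}" and u: "u \<in> {0..1}" and eq: "P t = G u"
    by (auto simp: path_image_def)
  have "P t $ 1 = G u $ 1" "P t $ 2 = G u $ 2" using eq by simp_all
  then have "max x1 (min x2 (Re (p t))) = Re (g u)" "Im (p t) = max y1 (min y2 (Im (g u)))"
    by (simp_all add: P_def G_def)
  then have "Re (p t) = Re (g u)" "Im (p t) = Im (g u)"
    using pin[OF t] gin[OF u] by (auto simp: max_def min_def split: if_splits)
  then have "p t = g u" by (simp add: complex_eq_iff)
  moreover have "p t \<in> path_image p" "g u \<in> path_image g"
    using t u by (auto simp: path_image_def)
  ultimately show thesis
    using that by metis
qed

section \<open>Positive harmonic functions on a strip\<close>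

definition strip :: "complex set" where
  "strip = {s. \<bar>Im s\<bar> < pi / 2}"

text \<open>The harmonic function on the rectangle \<open>X < Re s < X + \<pi>\<close>, \<open>|Im s| < b / 2\<close> that vanishes on three sides and is at
most 1 on the fourth, which is the lower side for \<open>\<sigma> = 1\<close> and the upper side for \<open>\<sigma> = -1\<close>.\<close>

definition side_barrier :: "real \<Rightarrow> real \<Rightarrow> real \<Rightarrow> complex \<Rightarrow> real" where
  "side_barrier X b \<sigma> s = sin (Re s - X) * sinh (b / 2 - \<sigma> * Im s) / sinh b"

lemma mean_value_on_side_barrier:
  assumes "\<sigma> = 1 \<or> \<sigma> = -1"
  shows "mean_value_on S (side_barrier X b \<sigma>)"
proof (rule mean_value_on_cong)
  show "mean_value_on S (\<lambda>s. Re (- \<i> * of_real \<sigma> * cos (s - of_real X - \<i> * of_real \<sigma> * of_real (b / 2)) / of_real (sinh b)))"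
    by (intro mean_value_on_Re holomorphic_intros) auto
  show "Re (- \<i> * of_real \<sigma> * cos (s - of_real X - \<i> * of_real \<sigma> * of_real (b / 2)) / of_real (sinh b)) = side_barrier X b \<sigma> s" for s
  proof -
    have Im_cos': "Im (cos z) = - (sin (Re z) * sinh (Im z))" for z
      by (simp add: Im_cos sinh_field_def field_simps)
    have odd: "sinh (Im s - b / 2) = - sinh (b / 2 - Im s)"
      by (metis minus_diff_eq sinh_minus)
    show ?thesis
      using assms by (auto simp: side_barrier_def Im_cos' odd add.commute Re_divide_of_real)
  qed
qed

text \<open>Since the barrier vanishes on the other three sides and \<open>V \<ge> 0\<close>, the set where \<open>V\<close> is below the barrier
can reach the boundary only on the side singled out by \<open>\<sigma>\<close>. The domain is enlarged beyond that side (up to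
\<open>d / 2\<close> with \<open>b < d < \<pi>\<close>), so that the path ends on or behind it.\<close>

lemma path_below_side_barrier:
  assumes mv: "mean_value_on strip V" and nonneg: "\<And>s. s \<in> strip \<Longrightarrow> V s \<ge> 0"
    and b: "0 < b" "b < pi" and \<sigma>: "\<sigma> = 1 \<or> \<sigma> = -1"
    and c: "X < Re c" "Re c < X + pi" "\<bar>Im c\<bar> < b / 2" "V c < side_barrier X b \<sigma> c"
  obtains g where "path g" "pathstart g = c" "\<sigma> * Im (pathfinish g) \<le> - b / 2"
    "path_image g \<subseteq> {s. X < Re s \<and> Re s < X + pi \<and> V s < side_barrier X b \<sigma> s}"
proof -
  define d where "d = (b + pi) / 2"
  have d: "b < d" "d < pi" using b by (auto simp: d_def)
  \<comment> \<open>\<open>B\<close> lies behind the side singled out by \<open>\<sigma>\<close>; the part of \<open>W\<close> in front of it is the rectangle on which the barrier is considered.\<close>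
  define W where "W = {s. X < Re s \<and> Re s < X + pi \<and> - d / 2 < \<sigma> * Im s \<and> \<sigma> * Im s < b / 2}"
  define B where "B = {s. \<sigma> * Im s \<le> - b / 2}"
  have openW: "open W"
    unfolding W_def by (intro open_Collect_conj open_Collect_less continuous_intros)
  have clW: "closure W \<subseteq> {s. X \<le> Re s \<and> Re s \<le> X + pi \<and> - d / 2 \<le> \<sigma> * Im s \<and> \<sigma> * Im s \<le> b / 2}"
    unfolding W_def by (rule closure_minimal)
      (auto intro!: closed_Collect_conj closed_Collect_le continuous_intros)
  have clWB: "closure (W - B) \<subseteq> {s. X \<le> Re s \<and> Re s \<le> X + pi \<and> - b / 2 \<le> \<sigma> * Im s \<and> \<sigma> * Im s \<le> b / 2}"
    unfolding W_def B_def by (rule closure_minimal)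
      (auto intro!: closed_Collect_conj closed_Collect_le continuous_intros)
  have "W \<subseteq> cbox (Complex X (- pi)) (Complex (X + pi) pi)"
    using \<sigma> b d by (auto simp: W_def in_cbox_complex_iff)
  then have bW: "bounded W" by (rule bounded_subset[OF bounded_cbox])
  have sub: "closure W \<subseteq> strip"
    using clW \<sigma> b d by (force simp: strip_def)
  have bd: "side_barrier X b \<sigma> s - V s \<le> 0" if s: "s \<in> frontier W" "s \<in> closure (W - B)" for s
  proof -
    have "s \<notin> W" "s \<in> closure W" using s(1) openW by (auto simp: frontier_def interior_open)
    then have "Re s = X \<or> Re s = X + pi \<or> \<sigma> * Im s = b / 2"
      using clWB s(2) d b unfolding W_def by force
    then have "side_barrier X b \<sigma> s = 0"
      by (auto simp: side_barrier_def)
    then show ?thesis using nonneg[of s] sub \<open>s \<in> closure W\<close> by auto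
  qed
  have cW: "c \<in> W" using c \<sigma> d by (auto simp: W_def)
  have mvd: "mean_value_on strip (\<lambda>s. side_barrier X b \<sigma> s - V s)"
    by (intro mean_value_on_diff mean_value_on_side_barrier \<sigma> mv)
  have pos: "side_barrier X b \<sigma> c - V c > 0"
    using c(4) by simp
  obtain g where g: "path g" "path_image g \<subseteq> {s\<in>W. side_barrier X b \<sigma> s - V s > 0}"
      "pathstart g = c" "pathfinish g \<in> B"
    by (rule positive_component_exits[OF mvd openW bW sub bd cW pos])
  show thesis
  proof (rule that[OF g(1,3)])
    show "\<sigma> * Im (pathfinish g) \<le> - b / 2"
      using g(4) by (simp add: B_def)
    show "path_image g \<subseteq> {s. X < Re s \<and> Re s < X + pi \<and> V s < side_barrier X b \<sigma> s}"
      using g(2) by (rule order_trans) (auto simp: W_def)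
  qed
qed

text \<open>If \<open>V\<close> were below both barriers at \<open>c\<close>, two paths would lead from \<open>c\<close> to the lower and to the upper
side. Joined, they cross the rectangle from bottom to top and must meet \<open>p\<close>, which crosses it from left to
right. But \<open>V \<ge> 1\<close> on \<open>p\<close>, while \<open>V\<close> lies below a barrier, hence below 1, on the two paths.\<close>

lemma min_side_barrier_le:
  assumes mv: "mean_value_on strip V" and nonneg: "\<And>s. s \<in> strip \<Longrightarrow> V s \<ge> 0"
    and b: "0 < b" "b < pi"
    and p: "path p" "Re (pathstart p) \<le> X" "X + pi \<le> Re (pathfinish p)"
      "\<And>z. z \<in> path_image p \<Longrightarrow> \<bar>Im z\<bar> < b / 2" "\<And>z. z \<in> path_image p \<Longrightarrow> V z \<ge> 1"
    and c: "X < Re c" "Re c < X + pi" "\<bar>Im c\<bar> < b / 2"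
  shows "min (side_barrier X b 1 c) (side_barrier X b (-1) c) \<le> V c"
proof (rule ccontr)
  assume "\<not> ?thesis"
  then have less: "V c < side_barrier X b 1 c" "V c < side_barrier X b (-1) c" by auto
  have signs: "(1::real) = 1 \<or> (1::real) = -1" "(-1::real) = 1 \<or> (-1::real) = -1"
    by auto
  obtain g1 where g1: "path g1" "pathstart g1 = c" "1 * Im (pathfinish g1) \<le> - b / 2"
    "path_image g1 \<subseteq> {s. X < Re s \<and> Re s < X + pi \<and> V s < side_barrier X b 1 s}"
    by (rule path_below_side_barrier[where V=V and c=c and X=X and b=b and \<sigma>=1, OF mv nonneg b signs(1) c less(1)])
  obtain g2 where g2: "path g2" "pathstart g2 = c" "-1 * Im (pathfinish g2) \<le> - b / 2"
    "path_image g2 \<subseteq> {s. X < Re s \<and> Re s < X + pi \<and> V s < side_barrier X b (-1) s}"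
    by (rule path_below_side_barrier[where V=V and c=c and X=X and b=b and \<sigma>="-1", OF mv nonneg b signs(2) c less(2)])
  define g where "g = reversepath g1 +++ g2"
  have g: "path g" "pathstart g = pathfinish g1" "pathfinish g = pathfinish g2"
    using g1 g2 by (auto simp: g_def)
  have img: "path_image g = path_image g1 \<union> path_image g2"
    using g1 g2 unfolding g_def by (subst path_image_join) auto
  have pb: "- b / 2 < Im z \<and> Im z < b / 2" if "z \<in> path_image p" for z
  proof -
    have "- (b / 2) < Im z \<and> Im z < b / 2"
      using p(4)[OF that] abs_less_iff[of "Im z" "b / 2"] minus_less_iff[of "Im z" "b / 2"] by blast
    then show ?thesis by simp
  qed
  have gb: "X < Re z \<and> Re z < X + pi" if "z \<in> path_image g" for z
    using that g1(4) g2(4) unfolding img by blast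
  have ends: "Im (pathstart g) \<le> - b / 2" "b / 2 \<le> Im (pathfinish g)"
    using g(2,3) g1(3) g2(3) by simp_all
  obtain z where z: "z \<in> path_image p" "z \<in> path_image g"
    by (rule crossing_paths_meet[where p=p and g=g, OF p(1-3) pb g(1) ends gb])
  have "side_barrier X b \<sigma> z \<le> 1" if "\<sigma> = 1 \<or> \<sigma> = -1" for \<sigma>
  proof -
    have "0 \<le> b / 2 - \<sigma> * Im z" "b / 2 - \<sigma> * Im z \<le> b"
      using p(4)[OF z(1)] that by auto
    then have "0 \<le> sinh (b / 2 - \<sigma> * Im z)" "sinh (b / 2 - \<sigma> * Im z) \<le> sinh b"
      by auto
    then have "sin (Re z - X) * sinh (b / 2 - \<sigma> * Im z) \<le> 1 * sinh b"
      by (intro mult_mono) auto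
    then show ?thesis
      using b by (simp add: side_barrier_def divide_le_eq)
  qed
  then have le_1: "side_barrier X b 1 z \<le> 1" "side_barrier X b (-1) z \<le> 1"
    by auto
  have "V z < side_barrier X b 1 z \<or> V z < side_barrier X b (-1) z"
    using z(2) g1(4) g2(4) unfolding img by blast
  then show False
    using le_1 p(5)[OF z(1)] by auto
qed

text \<open>On the middle segment \<open>Re s = X + \<pi> / 2\<close> of the rectangle, \<open>min_side_barrier_le\<close> bounds \<open>V\<close> from below by a
multiple of \<open>cos (\<pi> Im s / b)\<close>. The harmonic function \<open>q\<close> that equals this multiple on the segment and vanishes on the three other
sides of the rectangle between the segment and \<open>Re s = 1\<close>, is therefore a minorant of \<open>V\<close>. It decays along
the strip like \<open>exp (-\<pi> x / b)\<close>; the third condition on \<open>b\<close> says that \<open>b\<close> is so close to \<open>\<pi>\<close> that, over the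
distance in question, this differs from \<open>exp (-x)\<close> by a bounded factor.\<close>

lemma strip_lower_bound_of_width:
  assumes mv: "mean_value_on strip V" and nonneg: "\<And>s. s \<in> strip \<Longrightarrow> V s \<ge> 0"
    and p: "path p" "Re (pathstart p) \<le> X" "X + pi \<le> Re (pathfinish p)"
      "\<And>z. z \<in> path_image p \<Longrightarrow> \<bar>Im z\<bar> < b / 2" "\<And>z. z \<in> path_image p \<Longrightarrow> V z \<ge> 1"
    and X: "X + pi \<le> 0"
    and b: "0 < b" "b < pi" "pi / b * (1 - (X + pi / 2)) \<le> 2 - (X + pi / 2)"
  shows "exp (X - pi / 2 - 2) \<le> V 0"
proof -
  define x0 where "x0 = X + pi / 2"
  define \<kappa> where "\<kappa> = pi / b"
  have \<kappa>: "\<kappa> > 1" "\<kappa> * b = pi" using b(1,2) by (simp_all add: \<kappa>_def)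
  have x0: "x0 < 0" using X pi_gt_zero unfolding x0_def by linarith
  \<comment> \<open>The normalization for which the barrier \<open>q\<close> is at most \<open>sinh (b / 2 - |Im s|) / sinh b\<close> on the segment.\<close>
  define D where "D = \<kappa> * sinh b * sinh (\<kappa> * (1 - x0))"
  have D: "D > 0" using \<kappa>(1) b(1,2) x0 by (auto simp: D_def intro!: mult_pos_pos)
  define q where "q s = sinh (\<kappa> * (1 - Re s)) * cos (\<kappa> * Im s) / D" for s
  have mvq: "mean_value_on strip q"
  proof (rule mean_value_on_cong)
    show "mean_value_on strip (\<lambda>s. Re (sinh (of_real \<kappa> * (1 - s)) / of_real D))"
      using D by (intro mean_value_on_Re) (auto simp: sinh_field_def intro!: holomorphic_intros)
    show "Re (sinh (of_real \<kappa> * (1 - s)) / of_real D) = q s" for s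
      by (simp add: q_def sinh_field_def Re_exp Re_divide_of_real algebra_simps diff_divide_distrib)
  qed
  define S where "S = cbox (Complex x0 (- b / 2)) (Complex 1 (b / 2))"
  have "S \<subseteq> strip"
    using b(1,2) by (auto simp: S_def strip_def in_cbox_complex_iff)
  have "q s - V s \<le> 0" if s: "s \<in> frontier S" for s
  proof -
    have sS: "s \<in> S" "s \<notin> box (Complex x0 (- b / 2)) (Complex 1 (b / 2))"
      using s by (auto simp: S_def frontier_cbox)
    have Vs: "V s \<ge> 0" using nonneg sS(1) \<open>S \<subseteq> strip\<close> by blast
    consider "Re s = 1" | "\<bar>Im s\<bar> = b / 2" | "Re s = x0" "\<bar>Im s\<bar> < b / 2"
    proof -
      have "x0 \<le> Re s" "Re s \<le> 1" "- (b / 2) \<le> Im s" "Im s \<le> b / 2"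
        using sS(1) by (simp_all add: S_def in_cbox_complex_iff)
      moreover have "\<not> (x0 < Re s \<and> Re s < 1 \<and> - (b / 2) < Im s \<and> Im s < b / 2)"
        using sS(2) by (simp add: in_box_complex_iff)
      ultimately have "Re s = 1 \<or> \<bar>Im s\<bar> = b / 2 \<or> (Re s = x0 \<and> \<bar>Im s\<bar> < b / 2)"
        by argo
      then show thesis using that by blast
    qed
    then show ?thesis
    proof cases
      case 1 then show ?thesis using Vs by (simp add: q_def)
    next
      case 2
      then have "Im s = b / 2 \<or> Im s = - (b / 2)" by linarith
      then have "cos (\<kappa> * Im s) = 0"
      proof -
        assume y: "Im s = b / 2 \<or> Im s = - (b / 2)"
        have "\<kappa> * (b / 2) = pi / 2" using \<kappa>(2) by simp
        then show ?thesis
          using y by (auto simp only: mult_minus_right cos_minus cos_pi_half)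
      qed
      then show ?thesis using Vs by (simp add: q_def)
    next
      case 3
      define y where "y = b / 2 - \<bar>Im s\<bar>"
      have y: "y > 0" using 3 by (simp add: y_def)
      have "cos (\<kappa> * Im s) = cos (\<kappa> * \<bar>Im s\<bar>)"
        by (simp add: abs_if)
      also have "\<dots> = sin (\<kappa> * y)"
        using \<kappa> by (simp add: y_def cos_sin_eq algebra_simps)
      also have "\<dots> \<le> \<kappa> * y"
        using \<kappa> y by (intro sin_x_le_x) auto
      also have "\<dots> \<le> \<kappa> * sinh y"
        using real_le_x_sinh[of y] y \<kappa> by (intro mult_left_mono) (auto simp: sinh_field_def exp_minus)
      finally have "q s \<le> sinh (\<kappa> * (1 - x0)) * (\<kappa> * sinh y) / D"
        unfolding q_def 3 using D \<kappa> x0 by (intro divide_right_mono mult_left_mono) auto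
      also have "\<dots> = sinh y / sinh b"
        using \<kappa>(1) b(1,2) x0 by (simp add: D_def field_simps)
      also have "\<dots> \<le> min (side_barrier X b 1 s) (side_barrier X b (-1) s)"
        using b(1,2) 3 unfolding side_barrier_def y_def x0_def by (auto intro!: divide_right_mono)
      also have "\<dots> \<le> V s"
        using 3 by (intro min_side_barrier_le[OF mv nonneg b(1,2) p]) (auto simp: x0_def)
      finally show ?thesis by simp
    qed
  qed
  moreover have "compact S" "0 \<in> S"
    using x0 b(1) by (auto simp: S_def in_cbox_complex_iff)
  ultimately have "q 0 - V 0 \<le> 0"
    using maximum_principle[OF mean_value_on_diff[OF mvq mv]] \<open>S \<subseteq> strip\<close> by blast
  moreover have "exp (X - pi / 2 - 2) \<le> q 0"
  proof -
    have le_exp: "sinh x \<le> exp x" for x :: real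
    proof -
      have half: "(u - v) / 2 \<le> u" if "u > 0" "v > 0" for u v :: real
        using that by simp
      show ?thesis
        unfolding sinh_field_def by (rule half) simp_all
    qed
    have "D \<le> \<kappa> * exp pi * exp (2 - x0)"
      unfolding D_def
    proof (intro mult_mono)
      show "sinh b \<le> exp pi"
        using le_exp[of b] b(2) by (intro order_trans[OF le_exp[of b]]) simp
      show "sinh (\<kappa> * (1 - x0)) \<le> exp (2 - x0)"
        using b(3) unfolding \<kappa>_def[symmetric] x0_def[symmetric]
        by (intro order_trans[OF le_exp[of "\<kappa> * (1 - x0)"]]) simp
    qed (use \<kappa>(1) b(1) x0 in simp_all)
    then have "\<kappa> / (\<kappa> * exp pi * exp (2 - x0)) \<le> sinh \<kappa> / D"
    proof (intro frac_le)
      show "\<kappa> \<le> sinh \<kappa>"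
        using real_le_x_sinh[of \<kappa>] \<kappa> by (auto simp: sinh_field_def exp_minus)
    qed (use D \<kappa>(1) in simp_all)
    moreover have "\<kappa> / (\<kappa> * exp pi * exp (2 - x0)) = exp (- (pi + (2 - x0)))"
      using \<kappa> unfolding exp_minus exp_add by (simp add: divide_inverse)
    moreover have "- (pi + (2 - x0)) = X - pi / 2 - 2"
      by (simp add: x0_def field_simps)
    moreover have "q 0 = sinh \<kappa> / D"
      by (simp add: q_def)
    ultimately show ?thesis by (simp only:)
  qed
  ultimately show ?thesis by linarith
qed

text \<open>The compact path stays away from the edges of the strip, and \<open>b\<close> can be chosen as close to \<open>\<pi>\<close> as
\<open>strip_lower_bound_of_width\<close> requires.\<close>

lemma strip_lower_bound:
  assumes mv: "mean_value_on strip V" and nonneg: "\<And>s. s \<in> strip \<Longrightarrow> V s \<ge> 0"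
    and p: "path p" "path_image p \<subseteq> strip" "Re (pathstart p) \<le> X" "X + pi \<le> Re (pathfinish p)"
      "\<And>z. z \<in> path_image p \<Longrightarrow> V z \<ge> 1"
    and X: "X + pi \<le> 0"
  shows "exp (X - pi / 2 - 2) \<le> V 0"
proof -
  have "continuous_on (path_image p) (\<lambda>z. \<bar>Im z\<bar>)"
    by (intro continuous_intros)
  then obtain w where w: "w \<in> path_image p" "\<And>z. z \<in> path_image p \<Longrightarrow> \<bar>Im z\<bar> \<le> \<bar>Im w\<bar>"
    using continuous_attains_sup[OF compact_path_image[OF p(1)] path_image_nonempty] by blast
  have "\<bar>Im w\<bar> < pi / 2"
    using w(1) p(2) by (auto simp: strip_def)
  define l where "l = 1 - (X + pi / 2)"
  have l: "l > 0"
    using X pi_gt_zero unfolding l_def by linarith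
  have "max (2 * \<bar>Im w\<bar>) (pi * l / (l + 1)) < pi"
    using \<open>\<bar>Im w\<bar> < pi / 2\<close> l by (simp add: field_simps)
  then obtain b where b: "max (2 * \<bar>Im w\<bar>) (pi * l / (l + 1)) < b" "b < pi"
    using dense by blast
  have b0: "b > 0"
    using b(1) by (smt (verit) abs_ge_zero max_less_iff_conj)
  have "pi * l / (l + 1) < b"
    using b(1) by simp
  then have "pi / b * l \<le> l + 1"
    using l b0 by (simp add: field_simps)
  then have "pi / b * (1 - (X + pi / 2)) \<le> 2 - (X + pi / 2)"
    by (simp add: l_def)
  moreover have "\<bar>Im z\<bar> < b / 2" if "z \<in> path_image p" for z
    using w(2)[OF that] b(1) by simp
  ultimately show ?thesis
    by (intro strip_lower_bound_of_width[OF mv nonneg p(1,3,4) _ p(5) X b0 b(2)])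
qed

section \<open>Bounded potentials on non-polar sets\<close>

text \<open>For a measure on a compact set the positive part of the energy is finite, so energy different from
\<open>-\<infinity>\<close> means that the negative part is finite.\<close>

lemma non_polarE:
  assumes "non_polar E"
  obtains \<mu> K where "prob_space \<mu>" "sets \<mu> = sets borel" "compact K" "K \<subseteq> E"
    "AE s in \<mu>. s \<in> K"
    "(\<integral>\<^sup>+ z. (\<integral>\<^sup>+ w. (if z = w then \<infinity> else ennreal (- ln (cmod (z - w)))) \<partial>\<mu>) \<partial>\<mu>) \<noteq> \<infinity>"
proof -
  obtain \<mu> where \<mu>: "\<mu> \<in> compactly_supported_probs E" "log_energy \<mu> \<noteq> -\<infinity>"
    using assms unfolding non_polar_def log_capacity_def less_SUP_iff by (auto split: if_splits)
  then obtain K where K: "compact K" "K \<subseteq> E" "emeasure \<mu> K = 1" and ps: "prob_space \<mu>"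
    and sets: "sets \<mu> = sets borel"
    by (auto simp: compactly_supported_probs_def)
  interpret prob_space \<mu> by fact
  have "K \<in> sets \<mu>" using K(1) sets by (simp add: compact_imp_closed)
  then have AE: "AE s in \<mu>. s \<in> K"
    using K(3) by (intro AE_prob_1) (simp add: measure_def)
  obtain R where R: "R > 0" "\<And>z. z \<in> K \<Longrightarrow> cmod z \<le> R"
    using compact_imp_bounded[OF K(1)] bounded_pos by metis
  have le: "ennreal (ln (cmod (z - w))) \<le> ennreal (2 * R)" if "z \<in> K" "w \<in> K" for z w
  proof (rule ennreal_leI)
    have "cmod (z - w) \<le> 2 * R"
      using norm_triangle_ineq4[of z w] R(2)[OF that(1)] R(2)[OF that(2)] by linarith
    moreover have "ln (cmod (z - w)) \<le> cmod (z - w)"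
      using ln_bound[of "cmod (z - w)"] by (cases "z = w") auto
    ultimately show "ln (cmod (z - w)) \<le> 2 * R" by linarith
  qed
  have "(\<integral>\<^sup>+ z. (\<integral>\<^sup>+ w. ennreal (ln (cmod (z - w))) \<partial>\<mu>) \<partial>\<mu>) \<le> (\<integral>\<^sup>+ z. (\<integral>\<^sup>+ w. ennreal (2 * R) \<partial>\<mu>) \<partial>\<mu>)"
  proof (rule nn_integral_mono_AE, rule eventually_mono[OF AE])
    fix z assume z: "z \<in> K"
    show "(\<integral>\<^sup>+ w. ennreal (ln (cmod (z - w))) \<partial>\<mu>) \<le> (\<integral>\<^sup>+ w. ennreal (2 * R) \<partial>\<mu>)"
      by (rule nn_integral_mono_AE, rule eventually_mono[OF AE]) (rule le[OF z])
  qed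
  also have "\<dots> = ennreal (2 * R)"
    by (simp add: emeasure_space_1)
  finally have fin: "(\<integral>\<^sup>+ z. (\<integral>\<^sup>+ w. ennreal (ln (cmod (z - w))) \<partial>\<mu>) \<partial>\<mu>) \<noteq> \<infinity>"
    by (metis ennreal_less_top infinity_ennreal_def leD)
  have "(\<integral>\<^sup>+ z. (\<integral>\<^sup>+ w. (if z = w then \<infinity> else ennreal (- ln (cmod (z - w)))) \<partial>\<mu>) \<partial>\<mu>) \<noteq> \<infinity>"
  proof
    assume inf: "(\<integral>\<^sup>+ z. (\<integral>\<^sup>+ w. (if z = w then \<infinity> else ennreal (- ln (cmod (z - w)))) \<partial>\<mu>) \<partial>\<mu>) = \<infinity>"
    have "log_energy \<mu> = -\<infinity>"
      unfolding log_energy_def inf using fin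
      by (cases "\<integral>\<^sup>+ z. (\<integral>\<^sup>+ w. ennreal (ln (cmod (z - w))) \<partial>\<mu>) \<partial>\<mu>") (auto simp: enn2ereal_ennreal)
    then show False using \<mu>(2) by contradiction
  qed
  then show thesis
    using that[OF ps sets K(1,2) AE] by blast
qed

text \<open>The lower bound is uniform up to \<open>K\<close>: the measure is spread so evenly that its potential has no logarithmic
poles. This is what lets copies of it take the place of the absolutely continuous Riesz measure of \<open>Re \<surd>w\<close>.\<close>

locale bounded_potential = prob_space \<nu> for \<nu> :: "complex measure" +
  fixes K :: "complex set" and M :: real
  assumes sets_\<nu>: "sets \<nu> = sets borel"
    and compact_K: "compact K"
    and AE_K: "AE s in \<nu>. s \<in> K"
    and integral_ge: "\<And>w. w \<notin> K \<Longrightarrow> (\<integral>s. ln (cmod (w - s)) \<partial>\<nu>) \<ge> - M"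

text \<open>A replacement for the nearest point of \<open>A\<close>, which need not exist because \<open>A\<close> need not be closed; a point at
less than twice the distance serves as well, because \<open>w\<close> has positive distance to the closed set \<open>K\<close>.\<close>

lemma almost_nearest_point:
  fixes w :: complex
  assumes "compact K" "A \<subseteq> K" "A \<noteq> {}" "w \<notin> K"
  obtains z where "z \<in> A" "\<And>s. s \<in> A \<Longrightarrow> cmod (z - s) \<le> 3 * cmod (w - s)"
proof -
  have "0 < infdist w K"
    using assms by (intro infdist_pos_not_in_closed) (auto intro: compact_imp_closed)
  also have "infdist w K \<le> infdist w A"
    using assms by (intro infdist_mono)
  finally have pos: "0 < infdist w A" .
  have "\<exists>z\<in>A. dist w z < 2 * infdist w A"
  proof (rule ccontr)
    assume "\<not> ?thesis"
    then have "2 * infdist w A \<le> dist w z" if "z \<in> A" for z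
      using that by (simp add: not_less)
    then have "2 * infdist w A \<le> (INF z\<in>A. dist w z)"
      by (intro cINF_greatest assms(3))
    also have "\<dots> = infdist w A"
      using assms(3) by (simp add: infdist_notempty)
    finally have "2 * infdist w A \<le> infdist w A" .
    then show False using pos by simp
  qed
  then obtain z where z: "z \<in> A" "dist w z < 2 * infdist w A" by blast
  have "cmod (z - s) \<le> 3 * cmod (w - s)" if "s \<in> A" for s
    using infdist_le[OF that, of w] z(2) dist_triangle[of z s w]
    by (simp add: dist_norm norm_minus_commute)
  with z(1) that show thesis by blast
qed

text \<open>Finite energy makes \<open>n(z) = \<integral> ln\<^sup>- |z - w| d\<mu>(w)\<close> finite almost everywhere, so \<open>n \<le> m\<close> on a set \<open>A\<close> of positive
measure. Let \<open>\<nu>\<close> be \<open>\<mu>\<close> conditioned on \<open>A\<close>. At points of \<open>A\<close> the potential of \<open>\<nu>\<close> is bounded below by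
construction; at a point \<open>w\<close> off \<open>K\<close> it is compared with an almost nearest point \<open>z\<close> of \<open>A\<close>, which
satisfies \<open>|z - s| \<le> 3 |w - s|\<close> for all \<open>s\<close> in \<open>A\<close>.\<close>

lemma non_polar_bounded_potential:
  assumes "non_polar E"
  obtains \<nu> K M where "bounded_potential \<nu> K M" "K \<subseteq> E"
proof -
  obtain \<mu> K where ps: "prob_space \<mu>" and sets_\<mu>: "sets \<mu> = sets borel" and K: "compact K" "K \<subseteq> E"
    and AE: "AE s in \<mu>. s \<in> K"
    and fin: "(\<integral>\<^sup>+ z. (\<integral>\<^sup>+ w. (if z = w then \<infinity> else ennreal (- ln (cmod (z - w)))) \<partial>\<mu>) \<partial>\<mu>) \<noteq> \<infinity>"
    by (rule non_polarE[OF assms])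
  interpret prob_space \<mu> by fact
  note [measurable_cong] = sets_\<mu>
  define g :: "complex \<Rightarrow> complex \<Rightarrow> ennreal" where
    "g z w = (if cmod (z - w) = 0 then \<infinity> else ennreal (- ln (cmod (z - w))))" for z w
  define n where "n z = (\<integral>\<^sup>+ w. g z w \<partial>\<mu>)" for z
  have g_meas: "case_prod g \<in> borel_measurable (borel \<Otimes>\<^sub>M \<mu>)"
    unfolding g_def by measurable
  have n_meas [measurable]: "n \<in> borel_measurable borel"
    unfolding n_def by (rule borel_measurable_nn_integral[OF g_meas])
  have "(\<integral>\<^sup>+ z. n z \<partial>\<mu>) \<noteq> \<infinity>"
    using fin by (simp add: n_def g_def)
  then have n_fin: "AE z in \<mu>. n z \<noteq> \<infinity>"
    by (intro nn_integral_PInf_AE) measurable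
  have K_meas [measurable]: "K \<in> sets borel"
    using K(1) by (simp add: compact_imp_closed)
  \<comment> \<open>Otherwise \<open>n\<close> would be infinite almost everywhere, as the sublevel sets exhaust \<open>{n < \<infinity>}\<close>.\<close>
  have "\<exists>m::nat. emeasure \<mu> {z\<in>K. n z \<le> of_nat m} \<noteq> 0"
  proof (rule ccontr)
    assume "\<not> ?thesis"
    then have null: "emeasure \<mu> {z\<in>K. n z \<le> of_nat m} = 0" for m :: nat by blast
    have "AE z in \<mu>. z \<notin> {z\<in>K. n z \<le> of_nat m}" for m :: nat
      by (rule AE_not_in) (use null[of m] in \<open>auto simp: null_sets_def sets_\<mu>\<close>)
    then have "AE z in \<mu>. \<forall>m::nat. z \<notin> {z\<in>K. n z \<le> of_nat m}"
      unfolding AE_all_countable ..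
    with AE n_fin have "AE z in \<mu>. False"
    proof eventually_elim
      case (elim z)
      then obtain r where "n z = ennreal r" "r \<ge> 0" by (cases "n z") auto
      moreover obtain m :: nat where "r \<le> real m" using real_arch_simple by blast
      ultimately have "n z \<le> of_nat m" by (simp add: ennreal_of_nat_eq_real_of_nat ennreal_leI)
      with elim show ?case by blast
    qed
    then show False by simp
  qed
  then obtain m :: nat where m: "emeasure \<mu> {z\<in>K. n z \<le> of_nat m} \<noteq> 0" by blast
  define A where "A = {z\<in>K. n z \<le> of_nat m}"
  have A_meas [measurable]: "A \<in> sets borel"
    unfolding A_def by measurable
  have A: "emeasure \<mu> A \<noteq> 0" "emeasure \<mu> A \<noteq> \<infinity>" "A \<noteq> {}" "A \<subseteq> K"
  proof -
    show "emeasure \<mu> A \<noteq> 0" using m by (simp add: A_def)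
    then show "A \<noteq> {}" by auto
    show "emeasure \<mu> A \<noteq> \<infinity>" by simp
    show "A \<subseteq> K" by (auto simp: A_def)
  qed
  define M where "M = enn2real ((ennreal (ln 3) + of_nat m) / emeasure \<mu> A)"
  define \<nu> where "\<nu> = uniform_measure \<mu> A"
  have ge: "(\<integral>s. ln (cmod (w - s)) \<partial>\<nu>) \<ge> - M" if w: "w \<notin> K" for w
  proof (cases "integrable \<nu> (\<lambda>s. ln (cmod (w - s)))")
    case True
    obtain z where z: "z \<in> A" "\<And>s. s \<in> A \<Longrightarrow> cmod (z - s) \<le> 3 * cmod (w - s)"
      using almost_nearest_point[OF K(1) A(4,3) w] by blast
    have pt: "ennreal (- ln (cmod (w - s))) \<le> ennreal (ln 3) + g z s" if s: "s \<in> A" for s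
    proof (cases "z = s")
      case False
      have "w \<noteq> s" using w s A(4) by blast
      have "ln (cmod (z - s)) \<le> ln (3 * cmod (w - s))"
        using z(2)[OF s] False by (intro ln_mono) auto
      also have "\<dots> = ln 3 + ln (cmod (w - s))"
        using \<open>w \<noteq> s\<close> by (intro ln_mult_pos) auto
      finally have "ennreal (- ln (cmod (w - s))) \<le> ennreal (ln 3 + - ln (cmod (z - s)))"
        by (intro ennreal_leI) simp
      also have "\<dots> \<le> ennreal (ln 3) + ennreal (- ln (cmod (z - s)))"
        using ennreal_plus[of "ln 3" "- ln (cmod (z - s))"]
        by (cases "- ln (cmod (z - s)) \<ge> 0") (auto simp: ennreal_neg intro!: ennreal_leI)
      finally show ?thesis using False by (simp add: g_def)
    qed (simp add: g_def)
    have "(\<integral>\<^sup>+ s. ennreal (- ln (cmod (w - s))) \<partial>\<nu>)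
        = (\<integral>\<^sup>+ s. ennreal (- ln (cmod (w - s))) * indicator A s \<partial>\<mu>) / emeasure \<mu> A"
      unfolding \<nu>_def by (rule nn_integral_uniform_measure) measurable
    also have "\<dots> \<le> (\<integral>\<^sup>+ s. ennreal (ln 3) + g z s \<partial>\<mu>) / emeasure \<mu> A"
      by (intro divide_right_mono_ennreal nn_integral_mono) (auto simp: pt split: split_indicator)
    also have "(\<integral>\<^sup>+ s. ennreal (ln 3) + g z s \<partial>\<mu>) = ennreal (ln 3) + n z"
      unfolding n_def g_def by (subst nn_integral_add) (auto simp: emeasure_space_1)
    also have "\<dots> / emeasure \<mu> A \<le> (ennreal (ln 3) + of_nat m) / emeasure \<mu> A"
      using z(1) by (intro divide_right_mono_ennreal add_left_mono) (auto simp: A_def)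
    finally have "(\<integral>\<^sup>+ s. ennreal (- ln (cmod (w - s))) \<partial>\<nu>) \<le> (ennreal (ln 3) + of_nat m) / emeasure \<mu> A" .
    then have "enn2real (\<integral>\<^sup>+ s. ennreal (- ln (cmod (w - s))) \<partial>\<nu>) \<le> M"
      unfolding M_def using A(1,2)
      by (intro enn2real_mono) (auto simp: ennreal_divide_eq_top_iff less_top[symmetric] ennreal_of_nat_eq_real_of_nat)
    then show ?thesis
      by (subst real_lebesgue_integral_def[OF True]) (smt (verit) enn2real_nonneg)
  next
    case False
    then show ?thesis by (simp add: not_integrable_integral_eq M_def)
  qed
  have "bounded_potential \<nu> K M"
  proof (intro bounded_potential.intro bounded_potential_axioms.intro ge K(1))
    show "prob_space \<nu>" unfolding \<nu>_def using A by (intro prob_space_uniform_measure) auto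
    show "sets \<nu> = sets borel" by (simp add: \<nu>_def sets_\<mu>)
    show "AE s in \<nu>. s \<in> K"
      unfolding \<nu>_def using A by (intro AE_uniform_measureI) (auto simp: sets_\<mu>)
  qed
  with K(2) that show thesis by blast
qed

context bounded_potential
begin

definition potential :: "complex \<Rightarrow> real" where
  "potential w = (\<integral>s. ln (cmod (w - s)) \<partial>\<nu>)"

lemma K_nonempty: "K \<noteq> {}"
  using AE_K by auto

lemma infdist_K_pos: "w \<notin> K \<Longrightarrow> 0 < infdist w K"
  using compact_K K_nonempty by (intro infdist_pos_not_in_closed) (auto intro: compact_imp_closed)

lemma infdist_K_le: "s \<in> K \<Longrightarrow> infdist w K \<le> cmod (w - s)"
  using infdist_le[of s K w] by (simp add: dist_norm)

lemma K_bounded: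
  obtains R where "R \<ge> 1" "\<And>s. s \<in> K \<Longrightarrow> cmod s \<le> R"
proof -
  obtain B where "B > 0" "\<And>s. s \<in> K \<Longrightarrow> cmod s \<le> B"
    using compact_imp_bounded[OF compact_K] bounded_pos by metis
  then show thesis using that[of "max 1 B"] by force
qed

lemma ln_measurable [measurable]: "(\<lambda>s. ln (cmod (w - s))) \<in> borel_measurable \<nu>"
  using sets_\<nu> by (simp cong: measurable_cong_sets)

lemma integrable_ln:
  assumes "w \<notin> K" shows "integrable \<nu> (\<lambda>s. ln (cmod (w - s)))"
proof -
  obtain R where R: "R \<ge> 1" "\<And>s. s \<in> K \<Longrightarrow> cmod s \<le> R"
    using K_bounded by blast
  have "\<bar>ln (cmod (w - s))\<bar> \<le> \<bar>ln (infdist w K)\<bar> + \<bar>ln (cmod w + R)\<bar>" if "s \<in> K" for s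
  proof -
    have "ln (infdist w K) \<le> ln (cmod (w - s))"
      using infdist_K_pos[OF assms] infdist_K_le[OF that] by (intro ln_mono) auto
    moreover have "w \<noteq> s" using assms that by blast
    moreover have "cmod (w - s) \<le> cmod w + R"
      using norm_triangle_ineq4[of w s] R(2)[OF that] by linarith
    ultimately have "ln (cmod (w - s)) \<le> ln (cmod w + R)"
      by (intro ln_mono) auto
    with \<open>ln (infdist w K) \<le> ln (cmod (w - s))\<close> show ?thesis by linarith
  qed
  then show ?thesis
    by (intro integrable_const_bound[where B = "\<bar>ln (infdist w K)\<bar> + \<bar>ln (cmod w + R)\<bar>"])
       (auto intro: eventually_mono[OF AE_K])
qed

lemma potential_le:
  assumes "w \<notin> K" and R: "\<And>s. s \<in> K \<Longrightarrow> cmod s \<le> R"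
  shows "potential w \<le> ln (cmod w + R)"
proof -
  have "potential w \<le> (\<integral>s. ln (cmod w + R) \<partial>\<nu>)"
    unfolding potential_def
  proof (rule integral_mono_AE[OF integrable_ln[OF assms(1)]])
    show "AE s in \<nu>. ln (cmod (w - s)) \<le> ln (cmod w + R)"
    proof (rule eventually_mono[OF AE_K])
      fix s assume s: "s \<in> K"
      have "cmod (w - s) \<le> cmod w + R"
        using norm_triangle_ineq4[of w s] R[OF s] by linarith
      moreover have "w \<noteq> s" using assms s by blast
      ultimately show "ln (cmod (w - s)) \<le> ln (cmod w + R)"
        by (intro ln_mono) auto
    qed
  qed simp
  then show ?thesis by (simp add: prob_space)
qed

lemma potential_ge_ln:
  assumes "w \<notin> K" "l > 0" "\<And>s. s \<in> K \<Longrightarrow> l \<le> cmod (w - s)"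
  shows "ln l \<le> potential w"
proof -
  have "(\<integral>s. ln l \<partial>\<nu>) \<le> potential w"
    unfolding potential_def
  proof (rule integral_mono_AE[OF _ integrable_ln[OF assms(1)]])
    show "AE s in \<nu>. ln l \<le> ln (cmod (w - s))"
      using assms(2,3) by (intro eventually_mono[OF AE_K] ln_mono) auto
  qed simp
  then show ?thesis by (simp add: prob_space)
qed

text \<open>Far from \<open>K\<close> the potential behaves like the logarithm of the distance, up to a dipole term; where \<open>|Re w|\<close> is small the
bound \<open>-M\<close> applies, and a large \<open>C\<close> makes the left side smaller than that. Only the real part of \<open>w\<close> is kept, as
\<open>|w - s| \<ge> |Re w - Re s|\<close> and the measures will be placed along the real direction.\<close>

lemma potential_lower_bound:
  obtains C where "C \<ge> 0"
    "\<And>w. w \<notin> K \<Longrightarrow> ln (2 + \<bar>Re w\<bar>) - C / (1 + \<bar>Re w\<bar>) \<le> potential w"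
proof -
  obtain R where R: "R \<ge> 1" "\<And>s. s \<in> K \<Longrightarrow> cmod s \<le> R"
    using K_bounded by blast
  define m where "m = max 0 M"
  define C where "C = (2 * R + 2) * (m + 2 * R + 3)"
  have C: "C \<ge> 0" using R by (simp add: C_def m_def)
  have "ln (2 + \<bar>Re w\<bar>) - C / (1 + \<bar>Re w\<bar>) \<le> potential w" if w: "w \<notin> K" for w
  proof (cases "\<bar>Re w\<bar> \<ge> 2 * R + 1")
    case True
    define u where "u = \<bar>Re w\<bar>"
    have u: "u \<ge> 2 * R + 1" "u - R > 0" "(1 + u) / 2 \<le> u - R"
      using True R(1) by (auto simp: u_def field_simps)
    have "ln (u - R) \<le> potential w"
    proof (rule potential_ge_ln[OF w])
      fix s assume "s \<in> K"
      then show "u - R \<le> cmod (w - s)"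
        using R(2)[of s] abs_Re_le_cmod[of "w - s"] abs_Re_le_cmod[of s] unfolding u_def minus_complex.sel by linarith
    qed (use u in auto)
    moreover have "ln (2 + u) - ln (u - R) \<le> C / (1 + u)"
    proof -
      have "ln (2 + u) - ln (u - R) = ln ((2 + u) / (u - R))"
        using u R(1) by (intro ln_divide_pos[symmetric]) auto
      also have "\<dots> \<le> (2 + u) / (u - R) - 1"
        using u R(1) by (intro ln_le_minus_one) auto
      also have "\<dots> = (2 + R) / (u - R)"
        using u(2) by (simp add: field_simps)
      also have "\<dots> \<le> (2 + R) / ((1 + u) / 2)"
        using u R(1) by (intro divide_left_mono) auto
      also have "\<dots> = (2 * (2 + R)) / (1 + u)"
        by simp
      also have "\<dots> \<le> C / (1 + u)"
      proof (rule divide_right_mono)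
        have "2 * (2 + R) \<le> (2 * R + 2) * (2 * R + 3)"
          using R(1) mult_mono[of 1 R 1 R] by (simp add: algebra_simps)
        also have "\<dots> \<le> C"
          unfolding C_def using R(1) by (intro mult_left_mono) (auto simp: m_def)
        finally show "2 * (2 + R) \<le> C" .
      qed (use u R(1) in auto)
      finally show ?thesis .
    qed
    ultimately show ?thesis unfolding u_def by linarith
  next
    case False
    have "ln (2 + \<bar>Re w\<bar>) \<le> 2 + \<bar>Re w\<bar>"
      by (intro order_trans[OF ln_le_minus_one]) auto
    then have "ln (2 + \<bar>Re w\<bar>) + m \<le> m + 2 * R + 3"
      using False by linarith
    also have "\<dots> \<le> C / (1 + \<bar>Re w\<bar>)"
    proof -
      have "(m + 2 * R + 3) * (1 + \<bar>Re w\<bar>) \<le> (m + 2 * R + 3) * (2 * R + 2)"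
        using False R(1) by (intro mult_left_mono) (auto simp: m_def)
      then show ?thesis
        by (subst pos_le_divide_eq) (auto simp: C_def mult.commute add_pos_nonneg)
    qed
    finally have "ln (2 + \<bar>Re w\<bar>) - C / (1 + \<bar>Re w\<bar>) \<le> - m" by linarith
    also have "\<dots> \<le> potential w"
      using integral_ge[OF w] unfolding potential_def m_def by linarith
    finally show ?thesis .
  qed
  with C that show thesis by blast
qed

text \<open>As long as \<open>x\<close> and \<open>y\<close> have distance at least \<open>a / 2\<close> from \<open>s\<close>, \<open>ln |x - s|\<close> and \<open>ln |y - s|\<close> differ by at
most \<open>2 |x - y| / a\<close>; integration preserves this Lipschitz bound.\<close>

lemma continuous_on_potential: "continuous_on (- K) potential"
proof -
  have "isCont potential w" if w: "w \<notin> K" for w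
  proof -
    define a where "a = infdist w K"
    have a: "a > 0" unfolding a_def by (rule infdist_K_pos[OF w])
    have "\<bar>potential z - potential w\<bar> \<le> 2 * dist z w / a" if z: "dist z w < a / 2" for z
    proof -
      have aK: "a / 2 \<le> cmod (z - s)" "a \<le> cmod (w - s)" if "s \<in> K" for s
      proof -
        show "a \<le> cmod (w - s)" unfolding a_def by (rule infdist_K_le[OF that])
        moreover have "cmod (w - s) \<le> dist z w + cmod (z - s)"
          using dist_triangle[of w s z] by (simp add: dist_norm norm_minus_commute)
        moreover have "a = a / 2 + a / 2" by simp
        ultimately show "a / 2 \<le> cmod (z - s)" using z by argo
      qed
      have zK: "z \<notin> K" using aK(1)[of z] a by auto
      have le: "ln (cmod (x - s)) - ln (cmod (y - s)) \<le> 2 * dist x y / a"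
        if "a / 2 \<le> cmod (x - s)" "a / 2 \<le> cmod (y - s)" for x y s
      proof -
        have pos: "cmod (x - s) > 0" "cmod (y - s) > 0" using that a by linarith+
        have "ln (cmod (x - s)) - ln (cmod (y - s)) = ln (cmod (x - s) / cmod (y - s))"
          using pos by (intro ln_divide_pos[symmetric])
        also have "\<dots> \<le> cmod (x - s) / cmod (y - s) - 1"
          using pos by (intro ln_le_minus_one) auto
        also have "\<dots> = (cmod (x - s) - cmod (y - s)) / cmod (y - s)"
          using pos by (simp add: field_simps)
        also have "\<dots> \<le> dist x y / cmod (y - s)"
          using pos norm_triangle_ineq2[of "x - s" "y - s"] by (intro divide_right_mono) (auto simp: dist_norm)
        also have "\<dots> \<le> dist x y / (a / 2)"
          using that a pos by (intro divide_left_mono) auto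
        finally show ?thesis by (simp add: mult.commute)
      qed
      have "\<bar>potential z - potential w\<bar> = \<bar>\<integral>s. ln (cmod (z - s)) - ln (cmod (w - s)) \<partial>\<nu>\<bar>"
        unfolding potential_def using integrable_ln w zK by simp
      also have "\<dots> \<le> (\<integral>s. \<bar>ln (cmod (z - s)) - ln (cmod (w - s))\<bar> \<partial>\<nu>)"
        by (rule integral_abs_bound)
      also have "\<dots> \<le> (\<integral>s. 2 * dist z w / a \<partial>\<nu>)"
      proof (rule integral_mono_AE)
        show "AE s in \<nu>. \<bar>ln (cmod (z - s)) - ln (cmod (w - s))\<bar> \<le> 2 * dist z w / a"
        proof (rule eventually_mono[OF AE_K])
          fix s assume "s \<in> K"
          then have "a / 2 \<le> cmod (z - s)" "a / 2 \<le> cmod (w - s)" using aK a by force+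
          then show "\<bar>ln (cmod (z - s)) - ln (cmod (w - s))\<bar> \<le> 2 * dist z w / a"
            using le[of z s w] le[of w s z] by (simp add: dist_commute abs_le_iff)
        qed
      qed (use integrable_ln w zK in auto)
      finally show ?thesis by (simp add: prob_space)
    qed
    then have ev: "\<forall>\<^sub>F z in at w. norm (potential z - potential w) \<le> 2 * dist z w / a"
      using a by (auto simp: eventually_at intro!: exI[of _ "a / 2"])
    have "((\<lambda>z. 2 * dist z w / a) \<longlongrightarrow> 2 * dist w w / a) (at w)"
      using a by (intro tendsto_intros) auto
    then have "((\<lambda>z. 2 * dist z w / a) \<longlongrightarrow> 0) (at w)" by simp
    then have "((\<lambda>z. potential z - potential w) \<longlongrightarrow> 0) (at w)"
      by (rule Lim_null_comparison[OF ev])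
    then show "isCont potential w"
      unfolding isCont_def by (rule LIM_zero_cancel)
  qed
  then show ?thesis
    by (auto intro: continuous_at_imp_continuous_on)
qed

end

text \<open>A zero-free holomorphic function on a disc has a holomorphic logarithm, and \<open>ln |F|\<close> is its real part.\<close>

lemma circle_mean_ln_norm:
  assumes "F holomorphic_on cball c r" "r > 0" "\<And>z. z \<in> cball c r \<Longrightarrow> F z \<noteq> 0"
  shows "((\<lambda>t. ln (cmod (F (circlepath c r t)))) has_integral ln (cmod (F c))) {0..1}"
proof -
  have "contractible (cball c r)"
    by (intro convex_imp_contractible convex_cball)
  then obtain g where g: "g holomorphic_on cball c r" "\<And>z. z \<in> cball c r \<Longrightarrow> F z = exp (g z)"
    using contractible_imp_holomorphic_log[OF assms(1) _ assms(3)] by blast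
  have eq: "Re (g z) = ln (cmod (F z))" if "z \<in> cball c r" for z
    using g(2)[OF that] by simp
  have "((\<lambda>t. Re (g (circlepath c r t))) has_integral Re (g c)) {0..1}"
    using assms(2) by (intro mean_value_onD(2)[OF mean_value_on_Re[OF g(1)]]) auto
  moreover have "circlepath c r t \<in> cball c r" for t
    using assms(2) by (intro circlepath_mem_cball) auto
  moreover have "c \<in> cball c r" using assms(2) by simp
  ultimately show ?thesis by (simp only: eq)
qed

context bounded_potential
begin

text \<open>Each \<open>ln |\<eta> - s|\<close> has the mean value property because \<open>\<eta> - s\<close> has no zero; by Fubini's theorem the average over
\<open>s\<close> inherits it.\<close>

lemma mean_value_on_potential:
  assumes holo: "\<eta> holomorphic_on S" and avoid: "\<And>z. z \<in> S \<Longrightarrow> \<eta> z \<notin> K"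
  shows "mean_value_on S (\<lambda>z. potential (\<eta> z))"
  unfolding mean_value_on_def
proof (intro conjI allI impI)
  show cont: "continuous_on S (\<lambda>z. potential (\<eta> z))"
    using holo avoid by (intro continuous_on_compose2[OF continuous_on_potential] holomorphic_on_imp_continuous_on) auto
  fix c and r :: real assume r: "0 < r" "cball c r \<subseteq> S"
  define \<gamma> where "\<gamma> t = \<eta> (circlepath c r t)" for t
  have circ: "circlepath c r t \<in> cball c r" for t
    using r(1) by (intro circlepath_mem_cball) auto
  have cont_circ: "continuous_on UNIV (circlepath c r)"
    unfolding circlepath by (intro continuous_intros)
  have cont_\<gamma>: "continuous_on UNIV \<gamma>"
    unfolding \<gamma>_def using circ r(2)
    by (intro continuous_on_compose2[OF holomorphic_on_imp_continuous_on[OF holo] cont_circ]) auto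
  note [measurable_cong] = sets_\<nu>
  have [measurable]: "\<gamma> \<in> borel_measurable borel"
    using cont_\<gamma> by (rule borel_measurable_continuous_onI)
  have [measurable]: "K \<in> sets borel"
    using compact_K by (simp add: compact_imp_closed)
  have \<gamma>K: "\<gamma> t \<notin> K" for t
    unfolding \<gamma>_def using circ r(2) by (intro avoid) auto
  \<comment> \<open>Cutting off outside \<open>K\<close> makes the integrand bounded everywhere and not only almost everywhere.\<close>
  define f where "f t s = (if s \<in> K then ln (cmod (\<gamma> t - s)) else 0)" for t s
  define L where "L = restrict_space lborel {0..1::real}"
  have "prob_space L"
    unfolding L_def by (intro prob_space_restrict_space) auto
  interpret L: prob_space L by fact
  interpret pair_prob_space L \<nu> ..
  have cont_P: "continuous_on {0..1} (\<lambda>t. potential (\<gamma> t))"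
    using cont_\<gamma> \<gamma>K by (intro continuous_on_compose2[OF continuous_on_potential]) (auto intro: continuous_on_subset)
  have "compact ((\<lambda>(z, s). \<eta> z - s) ` (cball c r \<times> K))"
  proof (rule compact_continuous_image)
    show "continuous_on (cball c r \<times> K) (\<lambda>(z, s). \<eta> z - s)"
      using r(2) unfolding case_prod_unfold
      by (intro continuous_intros continuous_on_compose2[OF holomorphic_on_imp_continuous_on[OF holo]]) auto
  qed (intro compact_Times compact_K compact_cball)
  then have "compact ((\<lambda>w. ln (cmod w)) ` (\<lambda>(z, s). \<eta> z - s) ` (cball c r \<times> K))"
  proof (rule compact_continuous_image[rotated])
    have "\<eta> x \<noteq> s" if "x \<in> cball c r" "s \<in> K" for x s
      using avoid[of x] that r(2) by blast
    then have "w \<noteq> 0" if "w \<in> (\<lambda>(z, s). \<eta> z - s) ` (cball c r \<times> K)" for w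
      using that by force
    then show "continuous_on ((\<lambda>(z, s). \<eta> z - s) ` (cball c r \<times> K)) (\<lambda>w. ln (cmod w))"
      by (intro continuous_intros) auto
  qed
  then obtain B where B: "\<And>x. x \<in> (\<lambda>w. ln (cmod w)) ` (\<lambda>(z, s). \<eta> z - s) ` (cball c r \<times> K) \<Longrightarrow> norm x \<le> B"
    using compact_imp_bounded bounded_iff by metis
  have f_le: "norm (f t s) \<le> \<bar>B\<bar>" for t s
  proof (cases "s \<in> K")
    case True
    then have "norm (ln (cmod (\<gamma> t - s))) \<le> B"
      unfolding \<gamma>_def using circ by (intro B) force
    then show ?thesis using True by (simp add: f_def)
  qed (simp add: f_def)
  have f_meas: "case_prod f \<in> borel_measurable (L \<Otimes>\<^sub>M \<nu>)"
  proof -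
    have [measurable]: "\<gamma> \<in> borel_measurable L"
      unfolding L_def by (intro measurable_restrict_space1) simp
    show ?thesis unfolding f_def by measurable
  qed
  have f_int: "integrable (L \<Otimes>\<^sub>M \<nu>) (case_prod f)"
    using f_le by (intro P.integrable_const_bound[where B = "\<bar>B\<bar>"] f_meas) auto
  have inner_t: "(\<integral>t. f t s \<partial>L) = (if s \<in> K then ln (cmod (\<eta> c - s)) else 0)" for s
  proof (cases "s \<in> K")
    case True
    have int: "((\<lambda>t. ln (cmod (\<eta> (circlepath c r t) - s))) has_integral ln (cmod (\<eta> c - s))) {0..1}"
      using r holo avoid True
      by (intro circle_mean_ln_norm holomorphic_intros) (auto intro: holomorphic_on_subset)
    have "continuous_on {0..1} (\<lambda>t. ln (cmod (\<gamma> t - s)))"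
      using \<gamma>K True cont_\<gamma> by (intro continuous_intros continuous_on_subset[OF cont_\<gamma>]) auto
    then have "set_integrable lborel {0..1} (\<lambda>t. ln (cmod (\<gamma> t - s)))"
      by (rule borel_integrable_atLeastAtMost')
    then have "(LINT t:{0..1}|lborel. ln (cmod (\<gamma> t - s))) = integral {0..1} (\<lambda>t. ln (cmod (\<gamma> t - s)))"
      by (rule set_borel_integral_eq_integral)
    also have "\<dots> = ln (cmod (\<eta> c - s))"
      unfolding \<gamma>_def using int by (rule integral_unique)
    finally show ?thesis
      using True by (simp add: f_def L_def integral_restrict_space set_lebesgue_integral_def)
  qed (simp add: f_def)
  have inner_s: "(\<integral>s. (if s \<in> K then ln (cmod (w - s)) else 0) \<partial>\<nu>) = potential w" for w
    unfolding potential_def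
    by (intro integral_cong_AE) (auto intro: eventually_mono[OF AE_K])
  have "(\<integral>t. potential (\<gamma> t) \<partial>L) = (\<integral>t. (\<integral>s. f t s \<partial>\<nu>) \<partial>L)"
    by (simp add: inner_s f_def)
  also have "\<dots> = (\<integral>s. (\<integral>t. f t s \<partial>L) \<partial>\<nu>)"
    using Fubini_integral[OF f_int] by simp
  also have "\<dots> = potential (\<eta> c)"
    by (simp add: inner_t inner_s)
  finally have "(LINT t:{0..1}|lborel. potential (\<gamma> t)) = potential (\<eta> c)"
    by (simp add: L_def integral_restrict_space set_lebesgue_integral_def)
  then have "integral {0..1} (\<lambda>t. potential (\<gamma> t)) = potential (\<eta> c)"
    using set_borel_integral_eq_integral(2)[OF borel_integrable_atLeastAtMost'[OF cont_P]] by simp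
  then show "((\<lambda>t. potential (\<eta> (circlepath c r t))) has_integral potential (\<eta> c)) {0..1}"
    using integrable_integral[OF integrable_continuous_real[OF cont_P]] by (simp add: \<gamma>_def)
qed

end

section \<open>Summing translates of the potential\<close>

context bounded_potential
begin

text \<open>The potential of the measure with mass \<open>weight k\<close> on \<open>K - k\<close>, up to an additive constant; the term \<open>k = 0\<close>
carries the constant \<open>ln 0 = 0\<close>.\<close>

definition shifted_potential_sum :: "nat \<Rightarrow> complex \<Rightarrow> real" where
  "shifted_potential_sum n w = (\<Sum>k<n. weight k * (potential (w + of_nat k) - ln (real k)))"

text \<open>By \<open>potential_lower_bound\<close> the sum is at least its model on the real line minus the dipole errors, and the
latter add up to a constant.\<close>

lemma shifted_potential_sum_lower_bounds:
  obtains C where "C \<ge> 0"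
    "\<And>n w. (\<And>k. w + of_nat k \<notin> K) \<Longrightarrow> - C \<le> shifted_potential_sum n w"
    "\<And>n w. (\<And>k. w + of_nat k \<notin> K) \<Longrightarrow> real n / 2 \<le> Re w \<Longrightarrow>
       2 * ln (3 / 2) * sqrt (real n) - C \<le> shifted_potential_sum n w"
proof -
  obtain C where C: "C \<ge> 0"
    "\<And>w. w \<notin> K \<Longrightarrow> ln (2 + \<bar>Re w\<bar>) - C / (1 + \<bar>Re w\<bar>) \<le> potential w"
    using potential_lower_bound by blast
  have key: "(\<Sum>k<n. weight k * (ln (2 + \<bar>real k + Re w\<bar>) - ln (real k))) - 36 * C
      \<le> shifted_potential_sum n w" if w: "\<And>k. w + of_nat k \<notin> K" for n w
  proof -
    have "(\<Sum>k<n. weight k * (ln (2 + \<bar>real k + Re w\<bar>) - ln (real k))) - C * (\<Sum>k<n. weight k / (1 + \<bar>real k + Re w\<bar>))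
       = (\<Sum>k<n. weight k * ((ln (2 + \<bar>real k + Re w\<bar>) - C / (1 + \<bar>real k + Re w\<bar>)) - ln (real k)))"
      unfolding sum_distrib_left sum_subtractf[symmetric]
      by (intro sum.cong refl) (simp add: right_diff_distrib mult.commute)
    also have "\<dots> \<le> shifted_potential_sum n w"
      unfolding shifted_potential_sum_def
    proof (intro sum_mono mult_left_mono weight_nonneg diff_right_mono)
      fix k
      show "ln (2 + \<bar>real k + Re w\<bar>) - C / (1 + \<bar>real k + Re w\<bar>) \<le> potential (w + of_nat k)"
        using C(2)[OF w[of k]] by (simp add: add.commute)
    qed
    finally show ?thesis
      using mult_left_mono[OF weighted_inverse_sum_le[where n=n and u="Re w"] C(1)] by linarith
  qed
  show thesis
  proof (rule that[of "6 + 36 * C"])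
    show "- (6 + 36 * C) \<le> shifted_potential_sum n w" if "\<And>k. w + of_nat k \<notin> K" for n w
      using key[OF that, of n] weighted_log_sum_ge[where n=n and u="Re w"] by linarith
    show "2 * ln (3 / 2) * sqrt (real n) - (6 + 36 * C) \<le> shifted_potential_sum n w"
      if "\<And>k. w + of_nat k \<notin> K" "real n / 2 \<le> Re w" for n w
      using key[OF that(1), of n] weighted_log_sum_ge_sqrt[OF that(2)] by linarith
  qed (use C(1) in simp)
qed

lemma shifted_potential_sum_upper_bound:
  assumes w: "\<And>k. w + of_nat k \<notin> K"
  obtains C where "\<And>n. shifted_potential_sum n w \<le> C"
proof -
  obtain R where R: "R \<ge> 1" "\<And>s. s \<in> K \<Longrightarrow> cmod s \<le> R"
    using K_bounded by blast
  define B where "B = cmod w + R"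
  have B: "B \<ge> 1" using R(1) by (simp add: B_def add_increasing)
  have "shifted_potential_sum n w \<le> 2 * ln B + 12 * B" for n
  proof -
    have "shifted_potential_sum n w \<le> (\<Sum>k<n. weight k * (ln (B + real k) - ln (real k)))"
      unfolding shifted_potential_sum_def
    proof (intro sum_mono mult_left_mono weight_nonneg diff_right_mono)
      fix k
      have "potential (w + of_nat k) \<le> ln (cmod (w + of_nat k) + R)"
        by (rule potential_le[OF w R(2)])
      also have "\<dots> \<le> ln (B + real k)"
        using norm_triangle_ineq[of w "of_nat k"] R(1)
        by (intro ln_mono) (auto simp: B_def intro: add_nonneg_pos)
      finally show "potential (w + of_nat k) \<le> ln (B + real k)" .
    qed
    also have "\<dots> \<le> 2 * ln B + 12 * B"
      by (rule weighted_log_sum_le[OF B])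
    finally show ?thesis .
  qed
  with that show thesis by blast
qed

lemma mean_value_on_shifted_potential_sum:
  assumes "\<eta> holomorphic_on S" "\<And>z k. z \<in> S \<Longrightarrow> \<eta> z + of_nat k \<notin> K"
  shows "mean_value_on S (\<lambda>z. shifted_potential_sum n (\<eta> z))"
  unfolding shifted_potential_sum_def
  by (intro mean_value_on_sum mean_value_on_cmult mean_value_on_diff mean_value_on_const
      mean_value_on_potential holomorphic_intros assms)

end

section \<open>From the strip to the disc\<close>

text \<open>The conformal map of the strip \<open>|Im s| < \<pi> / 2\<close> onto the unit disc that sends 0 to 0 and the left end
of the strip to \<open>\<tau>\<close>. On the negative real axis, the distance to \<open>\<tau>\<close> becomes comparable to \<open>exp (Re s)\<close>.\<close>

definition strip_to_disc :: "complex \<Rightarrow> complex \<Rightarrow> complex" where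
  "strip_to_disc \<tau> s = \<tau> * (1 - exp s) / (1 + exp s)"

definition disc_to_strip :: "complex \<Rightarrow> complex \<Rightarrow> complex" where
  "disc_to_strip \<tau> z = Ln ((\<tau> - z) / (\<tau> + z))"

lemma Re_exp_pos_strip:
  assumes "s \<in> strip" shows "Re (exp s) > 0"
proof -
  have "- (pi / 2) < \<bar>Im s\<bar>"
    using pi_half_gt_zero abs_ge_zero[of "Im s"] by linarith
  then have "cos \<bar>Im s\<bar> > 0"
    using assms by (intro cos_gt_zero_pi) (auto simp: strip_def)
  then show ?thesis by (simp add: Re_exp)
qed

lemma norm_less_iff_Re_pos: "cmod (1 - w) < cmod (1 + w) \<longleftrightarrow> Re w > 0"
proof -
  have "cmod (1 - w) < cmod (1 + w) \<longleftrightarrow> (cmod (1 - w))\<^sup>2 < (cmod (1 + w))\<^sup>2"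
    by (metis norm_ge_zero power2_less_imp_less power_strict_mono zero_less_numeral)
  also have "\<dots> \<longleftrightarrow> Re w > 0"
    unfolding cmod_power2 by (simp add: power2_eq_square algebra_simps)
  finally show ?thesis .
qed

lemma strip_to_disc_mem:
  assumes "cmod \<tau> = 1" "s \<in> strip" shows "strip_to_disc \<tau> s \<in> unit_disc"
proof -
  have "cmod (1 - exp s) < cmod (1 + exp s)"
    using Re_exp_pos_strip[OF assms(2)] by (simp add: norm_less_iff_Re_pos)
  moreover from this have "cmod (1 + exp s) > 0"
    by (meson le_less_trans norm_ge_zero)
  ultimately show ?thesis
    using assms(1) by (simp add: strip_to_disc_def norm_mult norm_divide)
qed

lemma strip_to_disc_holomorphic: "strip_to_disc \<tau> holomorphic_on strip"
proof -
  have "1 + exp s \<noteq> 0" if "s \<in> strip" for s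
    using Re_exp_pos_strip[OF that] by (metis add.inverse_inverse add_eq_0_iff less_minus_one_simps(3) less_numeral_extra(1) not_less_iff_gr_or_eq one_complex.sel(1) uminus_complex.sel(1))
  then show ?thesis
    unfolding strip_to_disc_def by (intro holomorphic_intros) auto
qed

context
  fixes \<tau> :: complex assumes \<tau>: "cmod \<tau> = 1"
begin

lemma disc_add_boundary_nonzero: "z \<in> unit_disc \<Longrightarrow> \<tau> + z \<noteq> 0 \<and> \<tau> - z \<noteq> 0"
  using \<tau> by (auto simp: add_eq_0_iff)

lemma Re_cayley_pos:
  assumes "z \<in> unit_disc" shows "Re ((\<tau> - z) / (\<tau> + z)) > 0"
proof -
  define w where "w = (\<tau> - z) / (\<tau> + z)"
  have nz: "\<tau> + z \<noteq> 0" using disc_add_boundary_nonzero[OF assms] by blast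
  have "1 - w = 2 * z / (\<tau> + z)" "1 + w = 2 * \<tau> / (\<tau> + z)"
    using nz by (simp_all add: w_def field_simps)
  then have "cmod (1 - w) < cmod (1 + w)"
    using assms \<tau> nz by (simp add: norm_divide norm_mult divide_strict_right_mono)
  then show ?thesis unfolding w_def[symmetric] norm_less_iff_Re_pos .
qed

lemma disc_to_strip_mem: "z \<in> unit_disc \<Longrightarrow> disc_to_strip \<tau> z \<in> strip"
  using Re_Ln_pos_lt_imp[OF Re_cayley_pos] by (simp add: disc_to_strip_def strip_def)

lemma exp_disc_to_strip:
  assumes "z \<in> unit_disc" shows "exp (disc_to_strip \<tau> z) = (\<tau> - z) / (\<tau> + z)"
  using disc_add_boundary_nonzero[OF assms] by (simp add: disc_to_strip_def)

lemma strip_to_disc_to_strip: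
  assumes "z \<in> unit_disc" shows "strip_to_disc \<tau> (disc_to_strip \<tau> z) = z"
proof -
  have nz: "\<tau> + z \<noteq> 0" "\<tau> \<noteq> 0" using disc_add_boundary_nonzero[OF assms] \<tau> by auto
  have "1 - (\<tau> - z) / (\<tau> + z) = 2 * z / (\<tau> + z)" "1 + (\<tau> - z) / (\<tau> + z) = 2 * \<tau> / (\<tau> + z)"
    using nz by (simp_all add: field_simps)
  then show ?thesis
    unfolding strip_to_disc_def exp_disc_to_strip[OF assms] using nz by simp
qed

lemma continuous_on_disc_to_strip: "continuous_on unit_disc (disc_to_strip \<tau>)"
  unfolding disc_to_strip_def
proof (intro continuous_intros)
  show "(\<tau> - z) / (\<tau> + z) \<notin> \<real>\<^sub>\<le>\<^sub>0" if "z \<in> unit_disc" for z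
    using Re_cayley_pos[OF that] by (auto simp: complex_nonpos_Reals_iff)
qed (use disc_add_boundary_nonzero in auto)

lemma Re_disc_to_strip:
  assumes "z \<in> unit_disc" shows "Re (disc_to_strip \<tau> z) = ln (cmod ((\<tau> - z) / (\<tau> + z)))"
  unfolding disc_to_strip_def using disc_add_boundary_nonzero[OF assms] by (intro Re_Ln) auto

text \<open>Transported to the strip, the path starts at least \<open>\<pi>\<close> further to the left than it ends, so it crosses a rectangle of length \<open>\<pi>\<close>;
\<open>strip_lower_bound\<close> then bounds \<open>v 0\<close> from below by a multiple of \<open>exp (Re s)\<close>, where \<open>s\<close> is the image of \<open>b\<close>. This
exponential equals \<open>|\<tau> - b| / |\<tau> + b|\<close>.\<close>

lemma distance_le_of_path:
  assumes mv: "mean_value_on strip (\<lambda>s. v (strip_to_disc \<tau> s))"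
    and nonneg: "\<And>z. z \<in> unit_disc \<Longrightarrow> v z \<ge> 0"
    and p: "path p" "path_image p \<subseteq> unit_disc" "\<And>z. z \<in> path_image p \<Longrightarrow> v z \<ge> 1"
      "pathstart p = a" "pathfinish p = b"
    and a: "cmod ((\<tau> - a) / (\<tau> + a)) \<le> exp (- pi) * cmod ((\<tau> - b) / (\<tau> + b))"
    and b: "cmod ((\<tau> - b) / (\<tau> + b)) \<le> 1"
  shows "cmod (b - \<tau>) \<le> 2 * exp (3 * pi / 2 + 2) * v 0"
proof -
  define \<Lambda> where "\<Lambda> = disc_to_strip \<tau>"
  have ab: "a \<in> unit_disc" "b \<in> unit_disc"
    using p(2,4,5) pathstart_in_path_image pathfinish_in_path_image by blast+
  have pos: "cmod ((\<tau> - a) / (\<tau> + a)) > 0" "cmod ((\<tau> - b) / (\<tau> + b)) > 0"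
    using disc_add_boundary_nonzero ab by auto
  define X where "X = Re (\<Lambda> b) - pi"
  have "ln (cmod ((\<tau> - a) / (\<tau> + a))) \<le> ln (exp (- pi) * cmod ((\<tau> - b) / (\<tau> + b)))"
    using a pos by (intro ln_mono) auto
  also have "\<dots> = - pi + ln (cmod ((\<tau> - b) / (\<tau> + b)))"
    using pos(2) by (subst ln_mult_pos) auto
  finally have Xa: "Re (\<Lambda> a) \<le> X"
    unfolding X_def \<Lambda>_def Re_disc_to_strip[OF ab(1)] Re_disc_to_strip[OF ab(2)] by simp
  have Xb: "X + pi \<le> 0"
    unfolding X_def \<Lambda>_def Re_disc_to_strip[OF ab(2)] using b pos(2) by simp
  have "exp (X - pi / 2 - 2) \<le> v (strip_to_disc \<tau> 0)"
  proof (rule strip_lower_bound[OF mv])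
    show "v (strip_to_disc \<tau> s) \<ge> 0" if "s \<in> strip" for s
      by (intro nonneg strip_to_disc_mem \<tau> that)
    show "path (\<Lambda> \<circ> p)"
      unfolding \<Lambda>_def using p(2) by (intro path_continuous_image p(1) continuous_on_subset[OF continuous_on_disc_to_strip])
    show "path_image (\<Lambda> \<circ> p) \<subseteq> strip"
      using p(2) disc_to_strip_mem by (auto simp: path_image_compose \<Lambda>_def)
    show "Re (pathstart (\<Lambda> \<circ> p)) \<le> X" "X + pi \<le> Re (pathfinish (\<Lambda> \<circ> p))"
      using p(4,5) Xa by (simp_all add: pathstart_compose pathfinish_compose X_def)
    show "v (strip_to_disc \<tau> s) \<ge> 1" if s: "s \<in> path_image (\<Lambda> \<circ> p)" for s
    proof -
      obtain z where "z \<in> path_image p" "s = \<Lambda> z"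
        using s by (auto simp: path_image_compose)
      with p(2,3) show ?thesis
        by (auto simp: \<Lambda>_def strip_to_disc_to_strip)
    qed
  qed (rule Xb)
  also have "strip_to_disc \<tau> 0 = 0" by (simp add: strip_to_disc_def)
  finally have "exp (3 * pi / 2 + 2) * exp (X - pi / 2 - 2) \<le> exp (3 * pi / 2 + 2) * v 0"
    by (intro mult_left_mono) auto
  moreover have "exp (3 * pi / 2 + 2) * exp (X - pi / 2 - 2) = cmod ((\<tau> - b) / (\<tau> + b))"
  proof -
    have "exp (3 * pi / 2 + 2) * exp (X - pi / 2 - 2) = exp (Re (\<Lambda> b))"
      unfolding X_def exp_add[symmetric] by (simp add: field_simps)
    then show ?thesis
      unfolding \<Lambda>_def Re_disc_to_strip[OF ab(2)] using pos(2) by simp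
  qed
  moreover have "cmod (b - \<tau>) / 2 \<le> cmod ((\<tau> - b) / (\<tau> + b))"
  proof -
    have "cmod (\<tau> + b) \<le> 2"
      using norm_triangle_ineq[of \<tau> b] \<tau> ab(2) by simp
    then show ?thesis
      using disc_add_boundary_nonzero[OF ab(2)]
      unfolding norm_divide norm_minus_commute[of b \<tau>]
      by (intro divide_left_mono) auto
  qed
  ultimately show ?thesis by simp
qed

end

section \<open>The rate of convergence\<close>

lemma funpow_mem_disc:
  assumes "f ` unit_disc \<subseteq> unit_disc" "z \<in> unit_disc" shows "(f ^^ n) z \<in> unit_disc"
  by (induction n) (use assms in \<open>auto simp: image_subset_iff\<close>)

lemma continuous_on_funpow:
  assumes "continuous_on S f" "f ` S \<subseteq> S" shows "continuous_on S (f ^^ n)"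
proof (induction n)
  case (Suc n)
  have "(f ^^ n) ` S \<subseteq> S" using assms(2) by (induction n) auto
  then show ?case
    using continuous_on_compose2[OF assms(1) Suc] by (simp add: comp_def)
qed (simp add: id_def)

text \<open>Consecutive images share the point \<open>f\<^sup>k\<^sup>+\<^sup>1(z) = f\<^sup>k(f z)\<close>.\<close>

lemma path_connected_orbit:
  fixes f :: "'a::topological_space \<Rightarrow> 'a"
  assumes cont: "continuous_on S f" "f ` S \<subseteq> S"
    and C: "path_connected C" "C \<subseteq> S" "z \<in> C" "f z \<in> C"
  shows "path_connected (\<Union>k\<in>{n..n+m}. (f ^^ k) ` C)"
proof (induction m)
  case 0
  show ?case
    using path_connected_continuous_image[OF continuous_on_subset[OF continuous_on_funpow[OF cont] C(2)] C(1)] by simp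
next
  case (Suc m)
  have eq: "(\<Union>k\<in>{n..n+Suc m}. (f ^^ k) ` C) = (\<Union>k\<in>{n..n+m}. (f ^^ k) ` C) \<union> (f ^^ (n + Suc m)) ` C"
    by (simp add: atLeastAtMostSuc_conv Un_commute)
  have "(f ^^ (n + Suc m)) z = (f ^^ (n + m)) (f z)"
    by (simp add: funpow_swap1)
  then have "(f ^^ (n + Suc m)) z \<in> (\<Union>k\<in>{n..n+m}. (f ^^ k) ` C)"
    using C(4) by (metis UN_I atLeastAtMost_iff imageI le_add1 order_refl)
  moreover have "(f ^^ (n + Suc m)) z \<in> (f ^^ (n + Suc m)) ` C"
    using C(3) by (rule imageI)
  ultimately have "(\<Union>k\<in>{n..n+m}. (f ^^ k) ` C) \<inter> (f ^^ (n + Suc m)) ` C \<noteq> {}"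
    by blast
  then show ?case
    unfolding eq
    using path_connected_continuous_image[OF continuous_on_subset[OF continuous_on_funpow[OF cont] C(2)] C(1)]
    by (intro path_connected_Un Suc)
qed

theorem theorem8p8:
  fixes f :: "complex \<Rightarrow> complex" and \<tau> :: complex and \<Omega> :: "complex set"
  assumes "non_elliptic f"
    and "denjoy_wolff_point f \<tau>"
    and "koenigs_domain f \<Omega>"
    and "non_polar (frontier \<Omega>)"
  shows "\<forall>z\<in>unit_disc. \<exists>c::real. c > 0 \<and>
           (\<forall>n::nat. n \<ge> 1 \<longrightarrow> cmod ((f ^^ n) z - \<tau>) \<le> c / sqrt (real n))"
proof
  fix z :: complex assume z: "z \<in> unit_disc"
  have f: "f holomorphic_on unit_disc" "f ` unit_disc \<subseteq> unit_disc"
    using assms(1) by (auto simp: non_elliptic_def)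
  have \<tau>: "cmod \<tau> = 1" and lim: "(\<lambda>n. (f ^^ n) z) \<longlonglongrightarrow> \<tau>"
    using assms(2) z by (auto simp: denjoy_wolff_point_def)
  obtain h where "koenigs_pair f \<Omega> h"
    using assms(3) by (auto simp: koenigs_domain_def)
  then have \<Omega>: "open \<Omega>" and h: "h holomorphic_on unit_disc" "h ` unit_disc = \<Omega>"
    and hf: "\<And>z. z \<in> unit_disc \<Longrightarrow> h (f z) = h z + 1"
    by (auto simp: koenigs_pair_def asymptotically_starlike_at_infinity_def plane_domain_def)
  have iter: "(f ^^ k) w \<in> unit_disc" if "w \<in> unit_disc" for k w
    by (rule funpow_mem_disc[OF f(2) that])
  have h_iter: "h ((f ^^ k) w) = h w + of_nat k" if "w \<in> unit_disc" for k w
    by (induction k) (use hf iter[OF that] in \<open>auto simp: add_ac\<close>)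
  obtain \<nu> K M where "bounded_potential \<nu> K M" and K: "K \<subseteq> frontier \<Omega>"
    using non_polar_bounded_potential[OF assms(4)] by blast
  interpret bounded_potential \<nu> K M by fact
  have avoid: "h w + of_nat k \<notin> K" if "w \<in> unit_disc" for k w
  proof -
    have "h w + of_nat k \<in> \<Omega>"
      using h(2) h_iter[OF that, of k] iter[OF that, of k] by (metis imageI)
    then show ?thesis
      using K \<Omega> by (auto simp: frontier_def interior_open)
  qed
  obtain C where C: "C \<ge> 0"
    "\<And>n w. w \<in> unit_disc \<Longrightarrow> - C \<le> shifted_potential_sum n (h w)"
    "\<And>n w. w \<in> unit_disc \<Longrightarrow> real n / 2 \<le> Re (h w) \<Longrightarrow>
       2 * ln (3 / 2) * sqrt (real n) - C \<le> shifted_potential_sum n (h w)"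
    using shifted_potential_sum_lower_bounds avoid by (metis (no_types, lifting))
  obtain C' where C': "\<And>n. shifted_potential_sum n (h 0) \<le> C'"
    using shifted_potential_sum_upper_bound[of "h 0"] avoid[of 0] by auto
  define \<beta> where "\<beta> = 2 * ln (3 / 2 :: real)"
  have \<beta>: "\<beta> > 0" by (simp add: \<beta>_def)

  \<comment> \<open>Iterating \<open>f\<close> on this segment produces the curve that leads from the orbit to \<open>\<tau>\<close>.\<close>
  define \<Gamma> where "\<Gamma> = closed_segment z (f z)"
  have \<Gamma>: "\<Gamma> \<subseteq> unit_disc" "z \<in> \<Gamma>" "f z \<in> \<Gamma>" "path_connected \<Gamma>" "compact \<Gamma>"
  proof -
    have "f z \<in> unit_disc" using z f(2) by blast
    then show "\<Gamma> \<subseteq> unit_disc"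
      unfolding \<Gamma>_def by (intro closed_segment_subset z convex_ball)
  qed (simp_all add: \<Gamma>_def)
  have "compact (h ` \<Gamma>)"
    using h(1) \<Gamma> by (intro compact_continuous_image holomorphic_on_imp_continuous_on) (auto intro: holomorphic_on_subset)
  then obtain R where R: "\<And>w. w \<in> \<Gamma> \<Longrightarrow> cmod (h w) \<le> R"
    using compact_imp_bounded bounded_iff by (metis imageI)
  have cay: "(\<lambda>n. cmod ((\<tau> - (f ^^ n) z) / (\<tau> + (f ^^ n) z))) \<longlonglongrightarrow> 0"
  proof -
    have "\<tau> + \<tau> \<noteq> 0" using \<tau> by auto
    then have "(\<lambda>n. cmod ((\<tau> - (f ^^ n) z) / (\<tau> + (f ^^ n) z))) \<longlonglongrightarrow> cmod ((\<tau> - \<tau>) / (\<tau> + \<tau>))"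
      by (intro tendsto_intros lim)
    then show ?thesis by simp
  qed
  have "\<forall>\<^sub>F n in sequentially. cmod ((\<tau> - (f ^^ n) z) / (\<tau> + (f ^^ n) z)) < 1"
    using order_tendstoD(2)[OF cay, of 1] by simp
  then obtain N0 where N0: "\<And>n. n \<ge> N0 \<Longrightarrow> cmod ((\<tau> - (f ^^ n) z) / (\<tau> + (f ^^ n) z)) < 1"
    by (auto simp: eventually_sequentially)
  \<comment> \<open>From \<open>N\<close> on, \<open>n / 2\<close> exceeds the bound \<open>R\<close> for \<open>|h|\<close> on the segment, so \<open>h\<close> has real part at least \<open>n / 2\<close>
      on the \<open>k\<close>-th image of the segment for all \<open>k \<ge> n\<close>.\<close>
  define N where "N = max (Suc N0) (nat \<lceil>2 * R\<rceil>)"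
  define A where "A = 2 * exp (3 * pi / 2 + 2) * ((C' + C) / \<beta>)"
  have bound: "cmod ((f ^^ n) z - \<tau>) \<le> A / sqrt (real n)" if n: "n \<ge> N" for n
  proof -
    have n0: "n > 0" "n \<ge> N0" "real n / 2 \<ge> R"
      using n by (auto simp: N_def)
    define v where "v w = (shifted_potential_sum n (h w) + C) / (\<beta> * sqrt (real n))" for w
    have den: "\<beta> * sqrt (real n) > 0" using \<beta> n0 by simp
    have "0 < exp (- pi) * cmod ((\<tau> - (f ^^ n) z) / (\<tau> + (f ^^ n) z))"
      using disc_add_boundary_nonzero[OF \<tau> iter[OF z]] by simp
    then have "\<forall>\<^sub>F m in sequentially. cmod ((\<tau> - (f ^^ m) z) / (\<tau> + (f ^^ m) z))
        < exp (- pi) * cmod ((\<tau> - (f ^^ n) z) / (\<tau> + (f ^^ n) z))"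
      by (rule order_tendstoD(2)[OF cay])
    then obtain N1 where N1: "\<And>m. m \<ge> N1 \<Longrightarrow> cmod ((\<tau> - (f ^^ m) z) / (\<tau> + (f ^^ m) z))
        < exp (- pi) * cmod ((\<tau> - (f ^^ n) z) / (\<tau> + (f ^^ n) z))"
      by (auto simp: eventually_sequentially)
    define T where "T = (\<Union>k\<in>{n..n+N1}. (f ^^ k) ` \<Gamma>)"
    have "path_connected T"
      unfolding T_def
      by (rule path_connected_orbit[OF holomorphic_on_imp_continuous_on[OF f(1)] f(2) \<Gamma>(4,1,2,3)])
    moreover have "(f ^^ (n + N1)) z \<in> T" "(f ^^ n) z \<in> T"
      using \<Gamma>(2) by (auto simp: T_def)
    ultimately obtain p where p: "path p" "path_image p \<subseteq> T"
      "pathstart p = (f ^^ (n + N1)) z" "pathfinish p = (f ^^ n) z"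
      unfolding path_connected_def by blast
    have T: "w \<in> unit_disc \<and> v w \<ge> 1" if w: "w \<in> T" for w
    proof -
      obtain k u where k: "k \<ge> n" and u: "u \<in> \<Gamma>" "w = (f ^^ k) u"
        using w by (auto simp: T_def)
      have uD: "u \<in> unit_disc" using u \<Gamma>(1) by blast
      have wD: "w \<in> unit_disc" using u iter[OF uD] by simp
      have "Re (h w) = Re (h u) + real k"
        using h_iter[OF uD, of k] u by simp
      moreover have "- R \<le> Re (h u)"
        using R[OF u(1)] abs_Re_le_cmod[of "h u"] by linarith
      moreover have "real n = real n / 2 + real n / 2" by simp
      ultimately have "real n / 2 \<le> Re (h w)"
        using n0(3) k by (smt (verit) of_nat_mono)
      then have "\<beta> * sqrt (real n) \<le> shifted_potential_sum n (h w) + C"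
        using C(3)[OF wD] unfolding \<beta>_def by fastforce
      then show ?thesis
        using wD den by (simp add: v_def le_divide_eq)
    qed
    have mv: "mean_value_on strip (\<lambda>s. v (strip_to_disc \<tau> s))"
    proof -
      have "mean_value_on strip (\<lambda>s. shifted_potential_sum n (h (strip_to_disc \<tau> s)))"
      proof (rule mean_value_on_shifted_potential_sum)
        have "h \<circ> strip_to_disc \<tau> holomorphic_on strip"
          using strip_to_disc_mem[OF \<tau>]
          by (intro holomorphic_on_compose_gen[OF strip_to_disc_holomorphic h(1)]) auto
        then show "(\<lambda>s. h (strip_to_disc \<tau> s)) holomorphic_on strip" by (simp add: comp_def)
      qed (intro avoid strip_to_disc_mem \<tau>)
      then have "mean_value_on strip (\<lambda>s. 1 / (\<beta> * sqrt (real n)) *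
          (shifted_potential_sum n (h (strip_to_disc \<tau> s)) + C))"
        by (intro mean_value_on_cmult mean_value_on_add mean_value_on_const)
      then show ?thesis by (simp add: v_def)
    qed
    have "cmod ((f ^^ n) z - \<tau>) \<le> 2 * exp (3 * pi / 2 + 2) * v 0"
    proof (rule distance_le_of_path[OF \<tau> mv _ p(1) _ _ p(3,4)])
      show "v w \<ge> 0" if "w \<in> unit_disc" for w
        using C(2)[OF that, of n] den by (auto simp: v_def intro!: divide_nonneg_pos)
      show "path_image p \<subseteq> unit_disc" "\<And>w. w \<in> path_image p \<Longrightarrow> v w \<ge> 1"
        using p(2) T by blast+
      show "cmod ((\<tau> - (f ^^ (n + N1)) z) / (\<tau> + (f ^^ (n + N1)) z))
          \<le> exp (- pi) * cmod ((\<tau> - (f ^^ n) z) / (\<tau> + (f ^^ n) z))"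
        by (rule less_imp_le, rule N1) simp
      show "cmod ((\<tau> - (f ^^ n) z) / (\<tau> + (f ^^ n) z)) \<le> 1"
        by (rule less_imp_le, rule N0, rule n0)
    qed
    also have "\<dots> \<le> 2 * exp (3 * pi / 2 + 2) * ((C' + C) / (\<beta> * sqrt (real n)))"
      using C'[of n] den unfolding v_def by (intro mult_left_mono divide_right_mono) auto
    finally show ?thesis
      by (simp add: A_def)
  qed
  \<comment> \<open>The first \<open>N\<close> iterates are covered by the trivial bound 2.\<close>
  define c where "c = \<bar>A\<bar> + 2 * sqrt (real N) + 1"
  have "cmod ((f ^^ n) z - \<tau>) \<le> c / sqrt (real n)" if n: "n \<ge> 1" for n
  proof (cases "n \<ge> N")
    case True
    have "A \<le> c"
      using abs_ge_self[of A] real_sqrt_ge_zero[of "real N"] unfolding c_def by linarith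
    then have "A / sqrt (real n) \<le> c / sqrt (real n)"
      by (intro divide_right_mono) auto
    with bound[OF True] show ?thesis by linarith
  next
    case False
    have "cmod ((f ^^ n) z - \<tau>) \<le> 2"
      using norm_triangle_ineq4[of "(f ^^ n) z" \<tau>] \<tau> iter[OF z, of n] by simp
    also have "2 \<le> c / sqrt (real n)"
    proof -
      have "2 * sqrt (real n) \<le> c"
        using False unfolding c_def by (smt (verit) nat_le_linear of_nat_mono real_sqrt_le_iff)
      moreover have "sqrt (real n) > 0" using n by simp
      ultimately show ?thesis
        by (simp only: pos_le_divide_eq)
    qed
    finally show ?thesis .
  qed
  moreover have "c > 0" unfolding c_def by (smt (verit) real_sqrt_ge_zero of_nat_0_le_iff)
  ultimately show "\<exists>c>0. \<forall>n\<ge>1. cmod ((f ^^ n) z - \<tau>) \<le> c / sqrt (real n)" by blast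
qed

end
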